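(* Let $k$ be a positive integer. If $r>1$ is a real number, then the range of the function $\sigma_{-r,k}\colon S_k\to\mathbb{R}$ is dense in the interval $\left[1,\frac{\zeta(r)}{\zeta((k+1)r)}\right)$ if and only if $r\leq\eta_k$.
   Context: $\mathbb{N}$ denotes the set of positive integers, $\mathbb{P}$ the set of primes, and $\zeta$ the Riemann zeta function. For a positive integer $k$, $S_k=\{n\in\mathbb{N}: p^{k+1}\nmid n \text{ for all } p\in\mathbb{P}\}$. For real $t$, $\sigma_t\colon\mathbb{N}\to\mathbb{R}$ is $\sigma_t(n)=\sum_{d\mid n,\ d>0}d^t$, and $\sigma_{t,k}\colon S_k\to\mathbb{R}$ is the restriction of $\sigma_t$ to $S_k$. The constants $\eta_k$ are defined as follows. $\eta_1$ is the unique real number in the interval $(1,2)$ that satisfies $$\left(1+\frac{1}{2^{\eta_1}}\right)^2=\frac{\zeta(\eta_1)}{\zeta(2\eta_1)}.$$ For each integer $k>1$, $\eta_k$ is the unique real number in the interval $(1,2)$ that satisfies $$\left(\sum_{j=0}^k\frac{1}{2^{\eta_k j}}\right)\left(\sum_{j=0}^k\frac{1}{3^{\eta_k j}}\right)\left(1+\frac{1}{3^{\eta_k}}\right)=\frac{\zeta(\eta_k)}{\zeta((k+1)\eta_k)}.$$ *)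

theory Defs
  imports "HOL-Analysis.Analysis" "HOL-Computational_Algebra.Primes"
begin

(* The Riemann zeta function on real s > 1, where the Dirichlet series converges;
   for s \<le> 1 the value of the definition carries no meaning. *)
definition zeta :: "real \<Rightarrow> real" where
  "zeta s = (\<Sum>n. 1 / real (Suc n) powr s)"

definition power_free :: "nat \<Rightarrow> nat set" where
  "power_free k = {n. n > 0 \<and> (\<forall>p. prime p \<longrightarrow> \<not> p ^ (k + 1) dvd n)}"

(* Only meant for n > 0, as every d divides 0. *)
definition divisor_sigma :: "real \<Rightarrow> nat \<Rightarrow> real" where
  "divisor_sigma t n = (\<Sum>d | d dvd n \<and> d > 0. real d powr t)"

(* Only meant for k > 0.  The case k = 1 has an equation of its own; it is not the
   instance k = 1 of the general one. *)
definition eta :: "nat \<Rightarrow> real" where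
  "eta k =
    (if k = 1 then
       (THE x. 1 < x \<and> x < 2 \<and> (1 + 1 / 2 powr x) ^ 2 = zeta x / zeta (2 * x))
     else
       (THE x. 1 < x \<and> x < 2 \<and>
          (\<Sum>j=0..k. 1 / 2 powr (x * real j)) * (\<Sum>j=0..k. 1 / 3 powr (x * real j))
            * (1 + 1 / 3 powr x)
          = zeta x / zeta (real (k + 1) * x)))"

end

theory Submission
  imports Defs "HOL-Real_Asymp.Real_Asymp"
begin

text \<open>
  For a set \<open>A\<close> of natural numbers write \<open>dsum A r\<close> for the sum of all \<open>n powr - r\<close> with \<open>n \<in> A\<close>, and let
  \<open>rough k y\<close> be the set of \<open>(k + 1)\<close>-power-free numbers all of whose prime factors exceed \<open>y\<close>.  The tail
  of the Euler product over the primes beyond \<open>y\<close> is \<open>dsum (rough k y) r\<close>, and the full product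
  \<open>dsum (rough k 0) r\<close> is the quotient of zeta values in the theorem, because every positive integer is
  uniquely a \<open>(k + 1)\<close>-st power times a \<open>(k + 1)\<close>-power-free number.

  The range is dense if and only if every prime \<open>p\<close> satisfies \<open>1 + 1 / p powr r \<le> dsum (rough k p) r\<close>,
  which is called \<open>small_step k p r\<close> below.  If the inequality fails at \<open>p\<close>, no value lies strictly
  between the two sides: a number with a prime factor at most \<open>p\<close> has a value at least the left side,
  any other number has a value at most the right side (\<open>small_steps_if_dense\<close>).  If it holds at every
  prime, choosing the largest admissible exponent at one prime after another approximates every
  target, because the quotient that is left never exceeds the remaining tail of the product
  (\<open>greedy_approximation\<close>).

  It remains to determine for which \<open>r\<close> all these inequalities hold.  Multiplied by \<open>p powr r\<close>, the
  inequality says that the sum of \<open>(p / n) powr r\<close> over the \<open>p\<close>-rough numbers \<open>n > 1\<close> is at least 1.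
  Each term decreases strictly in \<open>r\<close>, so for each \<open>p\<close> there is a single threshold, at which equality
  holds (\<open>small_step_threshold\<close>).  The equation that defines \<open>eta k\<close> is this equality at \<open>p = 2\<close> if
  \<open>k = 1\<close> and at \<open>p = 3\<close> if \<open>k > 1\<close>, with the Euler factors of smaller primes multiplied in
  (\<open>eta_eq_pivot\<close>).  The other primes impose nothing stronger:

  \<^item> For \<open>p \<ge> 5\<close> and \<open>r \<le> 2\<close> the primes beyond \<open>p\<close> suffice, since the sum of \<open>(p / b)\<^sup>2\<close> over the primes
    \<open>b > p\<close> is at least 1.  A lower bound of Chebyshev type proves this for large \<open>p\<close>, and finitely
    many primes with successive ratios below the square root of 2 carry it down
    (\<open>small_step_large_prime\<close>).
  \<^item> For \<open>k > 1\<close> the step at 3 implies the step at 2 by elementary algebra for \<open>r \<le> 31 / 16\<close>, and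
    \<open>eta k\<close> is smaller than that (\<open>step_2_if_step_3\<close>).
  \<^item> For \<open>k = 1\<close> the step at 2 implies the step at 3 only if \<open>(3 / 2) powr r \<ge> 2 + 1 / 3 powr r\<close>, that is
    for \<open>r\<close> above 1.8637 approximately.  The threshold \<open>eta 1\<close> is 1.8646 approximately, so the
    implication is available at \<open>eta 1\<close> itself, and monotonicity transfers the step at 3 to all
    smaller exponents (\<open>squarefree_step_3_if_step_2\<close>).  The narrow window is why zeta is bounded to
    four decimal places at 233/125 = 1.864.
\<close>

section \<open>Dirichlet sums over sets of natural numbers\<close>

definition dsum :: "nat set \<Rightarrow> real \<Rightarrow> real" where
  "dsum A s = (\<Sum>\<^sub>\<infinity>n\<in>A. real n powr - s)"

lemma dsum_summable:
  assumes "s > 1"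
  shows "(\<lambda>n. real n powr - s) summable_on A"
proof -
  have "summable (\<lambda>n. real n powr - s)"
    using assms by (simp add: summable_real_powr_iff)
  hence "(\<lambda>n. real n powr - s) summable_on UNIV"
    by (subst summable_on_UNIV_nonneg_real_iff) auto
  thus ?thesis by (rule summable_on_subset_banach) simp
qed

lemma dsum_finite: "finite A \<Longrightarrow> dsum A s = (\<Sum>n\<in>A. real n powr - s)"
  by (simp add: dsum_def)

lemma dsum_mono: "s > 1 \<Longrightarrow> A \<subseteq> B \<Longrightarrow> dsum A s \<le> dsum B s"
  unfolding dsum_def by (rule infsum_mono2) (auto intro: dsum_summable)

lemma dsum_Un_disjoint:
  "s > 1 \<Longrightarrow> A \<inter> B = {} \<Longrightarrow> dsum (A \<union> B) s = dsum A s + dsum B s"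
  unfolding dsum_def by (rule infsum_Un_disjoint) (auto intro: dsum_summable)

lemma dsum_times_left:
  assumes "c > 0"
  shows "dsum ((*) c ` A) s = real c powr - s * dsum A s"
proof -
  have "inj_on ((*) c) A" using assms by (auto simp: inj_on_def)
  hence "dsum ((*) c ` A) s = (\<Sum>\<^sub>\<infinity>n\<in>A. real c powr - s * real n powr - s)"
    unfolding dsum_def by (subst infsum_reindex) (auto simp: o_def powr_mult)
  thus ?thesis by (simp add: dsum_def infsum_cmult_right')
qed

lemma dsum_product:
  assumes "s > 1" and inj: "inj_on (\<lambda>(a, b). a * b) (A \<times> B)"
  shows "dsum ((\<lambda>(a, b). a * b) ` (A \<times> B)) s = dsum A s * dsum B s"
proof -
  let ?f = "\<lambda>(a, b). a * b :: nat"
  let ?g = "\<lambda>n. real n powr - s"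
  have sm: "(?g \<circ> ?f) summable_on (A \<times> B)"
    using summable_on_reindex[OF inj] dsum_summable[OF assms(1)] by blast
  have eq: "?g \<circ> ?f = (\<lambda>(a, b). ?g a * ?g b)"
    by (auto simp: powr_mult fun_eq_iff)
  have "dsum (?f ` (A \<times> B)) s = infsum (\<lambda>(a, b). ?g a * ?g b) (A \<times> B)"
    unfolding dsum_def by (subst infsum_reindex[OF inj]) (simp only: eq)
  also have "\<dots> = (\<Sum>\<^sub>\<infinity>a\<in>A. \<Sum>\<^sub>\<infinity>b\<in>B. ?g a * ?g b)"
    using sm unfolding eq by (rule infsum_Sigma'_banach[symmetric])
  also have "\<dots> = dsum A s * dsum B s"
    by (simp add: dsum_def infsum_cmult_right' infsum_cmult_left')
  finally show ?thesis .
qed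

lemma zeta_eq_dsum:
  assumes "s > 1"
  shows "zeta s = dsum {1..} s"
proof -
  have "((\<lambda>n. real n powr - s) has_sum dsum {1..} s) {1..}"
    using dsum_summable[OF assms] unfolding dsum_def by (rule has_sum_infsum)
  moreover have "{1..} = range Suc"
    by (auto simp: image_iff Suc_le_eq gr0_conv_Suc)
  ultimately have "((\<lambda>n. real (Suc n) powr - s) has_sum dsum {1..} s) UNIV"
    by (simp add: has_sum_reindex o_def del: of_nat_Suc)
  hence "(\<lambda>n. real (Suc n) powr - s) sums dsum {1..} s"
    by (rule has_sum_imp_sums)
  thus ?thesis
    unfolding zeta_def by (simp add: sums_iff powr_minus_divide)
qed

lemma zeta_pos: "s > 1 \<Longrightarrow> zeta s > 0"
  using dsum_mono[of s "{1}" "{1..}"] by (simp add: zeta_eq_dsum dsum_finite)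

section \<open>Power-free numbers and rough numbers\<close>

lemma power_free_iff_multiplicity:
  "n \<in> power_free k \<longleftrightarrow> n > 0 \<and> (\<forall>p. prime p \<longrightarrow> multiplicity p n \<le> k)"
proof -
  have "\<not> p ^ (k + 1) dvd n \<longleftrightarrow> multiplicity p n \<le> k" if "prime p" "n > 0" for p
    using that by (subst power_dvd_iff_le_multiplicity) auto
  thus ?thesis unfolding power_free_def by auto
qed

lemma multiplicity_power_times:
  assumes "prime p" "m > 0" "s > (0::nat)"
  shows "multiplicity p (m ^ e * s) = e * multiplicity p m + multiplicity p s"
  using assms by (simp add: prime_elem_multiplicity_mult_distrib prime_elem_multiplicity_power_distrib)

text \<open>The multiplicity of a prime in \<open>m ^ (k + 1) * s\<close> has remainder \<open>multiplicity p s\<close> and quotient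
  \<open>multiplicity p m\<close> on division by \<open>k + 1\<close>, so it determines both factors.\<close>

lemma power_times_power_free_inj:
  "inj_on (\<lambda>(a, b). a * b) ((\<lambda>m. m ^ (k + 1)) ` {1..} \<times> power_free k)"
proof (rule inj_onI, clarsimp)
  fix m n s t :: nat
  assume m: "Suc 0 \<le> m" "Suc 0 \<le> n" and s: "s \<in> power_free k" "t \<in> power_free k"
    and eq: "m * m ^ k * s = n * n ^ k * t"
  hence pos: "m > 0" "n > 0" "s > 0" "t > 0" by (auto simp: power_free_def)
  have mult: "multiplicity p m = multiplicity p n \<and> multiplicity p s = multiplicity p t"
    if "prime p" for p
  proof -
    have "(k + 1) * multiplicity p m + multiplicity p s = (k + 1) * multiplicity p n + multiplicity p t"
      using eq pos that multiplicity_power_times[of p m s "k + 1"]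
        multiplicity_power_times[of p n t "k + 1"] by simp
    moreover have "multiplicity p s < k + 1" "multiplicity p t < k + 1"
      using s that by (auto simp: power_free_iff_multiplicity less_Suc_eq_le)
    ultimately show ?thesis
      by (metis add_left_cancel div_less div_mult_self4 add_cancel_right_left nat_neq_iff not_add_less1 add.commute)
  qed
  have "m = n" by (rule multiplicity_eq_nat) (use pos mult in auto)
  moreover have "s = t" by (rule multiplicity_eq_nat) (use pos mult in auto)
  ultimately show "m * m ^ k = n * n ^ k \<and> s = t" by simp
qed

lemma power_times_power_free_image:
  "(\<lambda>(a, b). a * b) ` ((\<lambda>m. m ^ (k + 1)) ` {1..} \<times> power_free k) = {1::nat..}"
proof -
  have ex: "\<exists>m s. m > 0 \<and> s \<in> power_free k \<and> n = m ^ (k + 1) * s" if "n > 0" for n :: nat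
    using that
  proof (induction n rule: less_induct)
    case (less n)
    show ?case
    proof (cases "n \<in> power_free k")
      case True
      thus ?thesis by (intro exI[of _ 1] exI[of _ n]) auto
    next
      case False
      with less.prems obtain p where p: "prime p" "p ^ (k + 1) dvd n"
        by (auto simp: power_free_def)
      from p(2) obtain n' where n': "n = p ^ (k + 1) * n'" ..
      have "n' > 0" using less.prems n' by (auto intro: Nat.gr0I)
      moreover have "1 < p ^ (k + 1)"
        by (rule one_less_power[OF prime_gt_1_nat[OF p(1)]]) simp
      hence "n' < n" using \<open>n' > 0\<close> n' by simp
      ultimately obtain m s where "m > 0" "s \<in> power_free k" "n' = m ^ (k + 1) * s"
        using less.IH by blast
      thus ?thesis using n' prime_gt_0_nat[OF p(1)]
        by (intro exI[of _ "p * m"] exI[of _ s]) (auto simp: power_mult_distrib)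
    qed
  qed
  have "n \<in> (\<lambda>(a, b). a * b) ` ((\<lambda>m. m ^ (k + 1)) ` {1..} \<times> power_free k)"
    if n: "n > 0" for n
  proof -
    from ex[OF n] obtain m s where "m > 0" "s \<in> power_free k" "n = m ^ (k + 1) * s" by blast
    thus ?thesis by (intro image_eqI[of _ _ "(m ^ (k + 1), s)"]) auto
  qed
  thus ?thesis
    by (auto simp: Suc_le_eq power_free_def)
qed

definition rough :: "nat \<Rightarrow> nat \<Rightarrow> nat set" where
  "rough k y = {n \<in> power_free k. \<forall>p. prime p \<longrightarrow> p dvd n \<longrightarrow> p > y}"

lemma rough_0: "rough k 0 = power_free k"
  by (auto simp: rough_def prime_gt_0_nat)

lemma one_in_rough: "1 \<in> rough k y"
  by (auto simp: rough_def power_free_iff_multiplicity)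

lemma prime_in_rough:
  assumes "prime p" "p > y" "k > 0"
  shows "p \<in> rough k y"
proof -
  have le1: "multiplicity q p \<le> 1" if "prime q" for q
    using that assms(1) by (cases "q = p") (auto simp: prime_multiplicity_other)
  hence "multiplicity q p \<le> k" if "prime q" for q
    using le1[OF that] assms(3) by linarith
  thus ?thesis
    using assms(1,2) prime_gt_0_nat[OF assms(1)] primes_dvd_imp_eq
    by (auto simp: rough_def power_free_iff_multiplicity)
qed

lemma dvd_in_rough:
  assumes "n \<in> rough k y" "d dvd n"
  shows "d \<in> rough k y"
proof -
  have n: "n > 0" using assms by (auto simp: rough_def power_free_def)
  hence "d > 0" using assms(2) by (auto intro: Nat.gr0I)
  moreover have "multiplicity p d \<le> multiplicity p n" for p
    using assms(2) n by (intro dvd_imp_multiplicity_le) auto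
  ultimately show ?thesis
    using assms by (auto simp: rough_def power_free_iff_multiplicity intro: le_trans dvd_trans)
qed

lemma rough_gt: "n \<in> rough k y \<Longrightarrow> n \<noteq> 1 \<Longrightarrow> n > y"
proof -
  assume n: "n \<in> rough k y" "n \<noteq> 1"
  then obtain p where "prime p" "p dvd n" using prime_factor_nat by blast
  with n show "n > y"
    using dvd_imp_le[of p n] by (auto simp: rough_def power_free_def)
qed

lemma zeta_eq_zeta_times_dsum:
  assumes "r > 1"
  shows "zeta r = zeta (real (k + 1) * r) * dsum (rough k 0) r"
proof -
  let ?P = "(\<lambda>m. m ^ (k + 1)) ` {1::nat..}"
  have "real (k + 1) * r \<ge> 1 * r"
    using assms by (intro mult_right_mono) auto
  hence kr: "real (k + 1) * r > 1" using assms by linarith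
  have inj: "inj_on (\<lambda>m. m ^ (k + 1)) {1::nat..}"
    by (rule inj_onI) (meson le0 power_eq_imp_eq_base zero_less_Suc add_gr_0 zero_less_one)
  have "dsum ?P r = dsum {1..} (real (k + 1) * r)"
    unfolding dsum_def
  proof (subst infsum_reindex[OF inj], rule infsum_cong)
    fix m :: nat assume "m \<in> {1..}"
    hence "real (m ^ (k + 1)) = real m powr real (k + 1)"
      by (subst powr_realpow) auto
    thus "((\<lambda>n. real n powr - r) \<circ> (\<lambda>m. m ^ (k + 1))) m = real m powr - (real (k + 1) * r)"
      by (simp only: o_def powr_powr) simp
  qed
  moreover have "dsum {1..} r = dsum ?P r * dsum (power_free k) r"
    using dsum_product[OF assms power_times_power_free_inj, of k]
    by (simp only: power_times_power_free_image)
  ultimately show ?thesis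
    using assms kr by (simp add: zeta_eq_dsum rough_0)
qed

lemma prime_power_times_inj:
  assumes p: "prime (p :: nat)" and B: "\<And>n. n \<in> B \<Longrightarrow> \<not> p dvd n"
  shows "inj_on (\<lambda>(a, b). a * b) ((\<lambda>j. p ^ j) ` A \<times> B)"
proof (rule inj_onI, clarsimp)
  fix i j m n
  assume m: "m \<in> B" "n \<in> B" and eq: "p ^ i * m = p ^ j * n"
  have p0: "p \<noteq> 0" using p by auto
  have "multiplicity p (p ^ i * m) = i" "multiplicity p (p ^ j * n) = j"
    by (rule multiplicity_decomposeI[OF refl _ p0], rule B, rule m)+
  with eq have "i = j" by simp
  with eq p0 show "p ^ i = p ^ j \<and> m = n" by simp
qed

text \<open>Splitting off the power of \<open>p\<close> from a number; this turns into the Euler factor at \<open>p\<close>.\<close>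

lemma rough_prime_image:
  assumes p: "prime p"
  shows "rough k (p - 1) = (\<lambda>(a, b). a * b) ` ((\<lambda>j. p ^ j) ` {0..k} \<times> rough k p)"
proof (intro set_eqI iffI)
  fix n assume n: "n \<in> rough k (p - 1)"
  hence n0: "n > 0" by (simp add: rough_def power_free_def)
  have "n \<noteq> 0" "\<not> is_unit p" using n0 p by auto
  then obtain m where m: "n = p ^ multiplicity p n * m" "\<not> p dvd m"
    using multiplicity_decompose' by blast
  hence "m \<in> rough k (p - 1)" using dvd_in_rough[OF n] by (metis dvd_triv_right)
  moreover have "q > p" if "prime q" "q dvd m" "q > p - 1" for q
    using that m(2) by (cases "q = p") auto
  ultimately have "m \<in> rough k p" by (auto simp: rough_def)
  moreover have "multiplicity p n \<le> k"
    using n p by (auto simp: rough_def power_free_iff_multiplicity)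
  ultimately show "n \<in> (\<lambda>(a, b). a * b) ` ((\<lambda>j. p ^ j) ` {0..k} \<times> rough k p)"
    using m(1) by force
next
  fix n assume "n \<in> (\<lambda>(a, b). a * b) ` ((\<lambda>j. p ^ j) ` {0..k} \<times> rough k p)"
  then obtain j m where j: "j \<le> k" "m \<in> rough k p" "n = p ^ j * m" by auto
  have m0: "m > 0" using j(2) by (auto simp: rough_def power_free_def)
  have p0: "p > 0" using p prime_gt_0_nat by blast
  have ndvd: "\<not> p dvd m" using j(2) p by (auto simp: rough_def)
  have "multiplicity q n \<le> k" if q: "prime q" for q
  proof (cases "q = p")
    case True
    have "multiplicity p n = j"
      by (rule multiplicity_decomposeI[OF j(3) ndvd]) (use p0 in simp)
    thus ?thesis using j True by simp
  next
    case False
    hence "multiplicity q n = multiplicity q m"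
      using multiplicity_power_times[OF q p0 m0, of j] p q j(3)
      by (simp add: prime_multiplicity_other)
    thus ?thesis using j(2) q by (auto simp: rough_def power_free_iff_multiplicity)
  qed
  moreover have "q > p - 1" if "prime q" "q dvd n" for q
  proof -
    from that j(3) have "q dvd p ^ j \<or> q dvd m" by (simp add: prime_dvd_mult_iff)
    thus ?thesis
      using that p p0 j(2) prime_dvd_power[of q p j]
      by (auto simp: rough_def primes_dvd_imp_eq dest: primes_dvd_imp_eq)
  qed
  moreover have "n > 0" using j m0 p0 by simp
  ultimately show "n \<in> rough k (p - 1)"
    by (simp add: rough_def power_free_iff_multiplicity)
qed

lemma rough_nonprime:
  assumes "\<not> prime (Suc y)"
  shows "rough k (Suc y) = rough k y"
proof -
  have "p > Suc y \<longleftrightarrow> p > y" if "prime p" for p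
    using that assms by (cases "p = Suc y") auto
  thus ?thesis unfolding rough_def by blast
qed

lemma not_dvd_rough: "prime p \<Longrightarrow> n \<in> rough k p \<Longrightarrow> \<not> p dvd n"
  by (auto simp: rough_def)

text \<open>The truncation parameter \<open>j\<close> is separate from the exponent bound \<open>k\<close> because the values of
  the divisor function at prime powers \<open>p ^ j\<close> are the same sums.\<close>

definition euler_factor :: "nat \<Rightarrow> nat \<Rightarrow> real \<Rightarrow> real" where
  "euler_factor j p r = (\<Sum>i=0..j. 1 / real p powr (r * real i))"

lemma dsum_prime_powers:
  assumes p: "prime p"
  shows "dsum ((\<lambda>i. p ^ i) ` {0..j}) r = euler_factor j p r"
proof -
  have inj: "inj_on (\<lambda>i. p ^ i) {0..j}"
    using prime_gt_1_nat[OF p] by (auto simp: inj_on_def)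
  have "dsum ((\<lambda>i. p ^ i) ` {0..j}) r = (\<Sum>i=0..j. real (p ^ i) powr - r)"
    by (subst dsum_finite) (auto simp: sum.reindex[OF inj])
  also have "\<dots> = euler_factor j p r"
    unfolding euler_factor_def
  proof (rule sum.cong[OF refl])
    fix i
    have "real (p ^ i) = real p powr real i"
      using prime_gt_0_nat[OF p] by (simp add: powr_realpow)
    thus "real (p ^ i) powr - r = 1 / real p powr (r * real i)"
      by (simp only: powr_powr powr_minus_divide[symmetric]) (simp add: mult.commute)
  qed
  finally show ?thesis .
qed

lemma dsum_rough_prime:
  assumes "prime p" "r > 1"
  shows "dsum (rough k (p - 1)) r = euler_factor k p r * dsum (rough k p) r"
proof -
  have "inj_on (\<lambda>(a, b). a * b) ((\<lambda>j. p ^ j) ` {0..k} \<times> rough k p)"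
    by (rule prime_power_times_inj[OF assms(1)]) (use not_dvd_rough assms(1) in blast)
  from dsum_product[OF assms(2) this] show ?thesis
    by (simp only: rough_prime_image[OF assms(1)] dsum_prime_powers[OF assms(1)])
qed

text \<open>Splitting off the Euler factors of 2 and, below, of 3 leaves the tails that occur in the steps at
  these primes.\<close>

lemma zeta_factor_2:
  assumes "r > 1"
  shows "zeta r = zeta (real (k + 1) * r) * (euler_factor k 2 r * dsum (rough k 2) r)"
proof -
  have "rough k (2 - 1) = rough k 0" using rough_nonprime[of 0 k] by simp
  thus ?thesis
    using zeta_eq_zeta_times_dsum[OF assms, of k] dsum_rough_prime[OF two_is_prime_nat assms, of k]
    by simp
qed

lemma dsum_rough_2:
  assumes "r > 1"
  shows "dsum (rough k 2) r = euler_factor k 3 r * dsum (rough k 3) r"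
  using dsum_rough_prime[OF _ assms, of 3 k] by simp

lemma zeta_quotient:
  assumes "r > 1"
  shows "zeta r / zeta (real (k + 1) * r) = euler_factor k 2 r * dsum (rough k 2) r"
proof -
  have "1 * r \<le> real (k + 1) * r" using assms by (intro mult_right_mono) auto
  hence "zeta (real (k + 1) * r) > 0" using assms by (intro zeta_pos) linarith
  thus ?thesis using zeta_factor_2[OF assms, of k] by simp
qed

section \<open>The density criterion\<close>

text \<open>Reading the divisor function as a Dirichlet sum over the divisors lets one product lemma serve
  both for its multiplicativity and for the Euler product.\<close>

lemma divisor_sigma_eq_dsum:
  "n > 0 \<Longrightarrow> divisor_sigma (- r) n = dsum {d. d dvd n} r"
  unfolding divisor_sigma_def
  by (subst dsum_finite) (auto intro!: sum.cong intro: Nat.gr0I)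

lemma divisor_sigma_prime_power_times:
  assumes p: "prime p" "\<not> p dvd m" "r > 1"
  shows "divisor_sigma (- r) (p ^ j * m) = euler_factor j p r * divisor_sigma (- r) m"
proof -
  let ?A = "(\<lambda>i. p ^ i) ` {0..j}" and ?B = "{d. d dvd m}"
  have m: "m > 0" using p(2) by (auto intro: Nat.gr0I)
  have "inj_on (\<lambda>(a, b). a * b) (?A \<times> ?B)"
    by (rule prime_power_times_inj[OF p(1)]) (use p(2) dvd_trans in blast)
  moreover have "(\<lambda>(a, b). a * b) ` (?A \<times> ?B) = {d. d dvd p ^ j * m}"
  proof (intro set_eqI iffI)
    fix d assume "d \<in> {d. d dvd p ^ j * m}"
    then obtain a b where ab: "d = a * b" "a dvd p ^ j" "b dvd m"
      using division_decomp by blast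
    then obtain i where "i \<le> j" "a = p ^ i"
      using divides_primepow_nat[OF p(1)] by blast
    with ab show "d \<in> (\<lambda>(a, b). a * b) ` (?A \<times> ?B)" by auto
  next
    fix d assume "d \<in> (\<lambda>(a, b). a * b) ` (?A \<times> ?B)"
    thus "d \<in> {d. d dvd p ^ j * m}" by (auto intro!: mult_dvd_mono le_imp_power_dvd)
  qed
  ultimately have "dsum {d. d dvd p ^ j * m} r = dsum ?A r * dsum ?B r"
    using dsum_product[OF p(3), of ?A ?B] by simp
  thus ?thesis
    using m prime_gt_0_nat[OF p(1)] p(1)
    by (simp add: divisor_sigma_eq_dsum dsum_prime_powers)
qed

lemma euler_factor_0: "p > 0 \<Longrightarrow> euler_factor 0 p r = 1"
  by (simp add: euler_factor_def)

lemma euler_factor_Suc: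
  "euler_factor (Suc j) p r = euler_factor j p r + 1 / real p powr (r * real (Suc j))"
  by (simp add: euler_factor_def)

lemma euler_factor_ge_1: "p > 0 \<Longrightarrow> 1 \<le> euler_factor j p r"
  by (induction j) (simp_all add: euler_factor_0 euler_factor_Suc add_increasing2 del: of_nat_Suc)

text \<open>The ratio of consecutive partial Euler factors is largest at the first one.  Therefore a single
  inequality for each prime, the one with exponent 1, controls all digits of the greedy algorithm.\<close>

lemma euler_factor_Suc_le:
  assumes "p > 0" "r > 0"
  shows "euler_factor (Suc j) p r \<le> (1 + 1 / real p powr r) * euler_factor j p r"
proof -
  have "real p powr r \<le> real p powr (r * real (Suc j))"
    using assms by (intro powr_mono) auto
  hence "1 / real p powr (r * real (Suc j)) \<le> 1 / real p powr r"
    using assms by (intro divide_left_mono) auto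
  also have "\<dots> \<le> 1 / real p powr r * euler_factor j p r"
    using euler_factor_ge_1[OF assms(1), of j r] mult_left_mono[of 1 "euler_factor j p r" "1 / real p powr r"]
    by simp
  finally show ?thesis by (simp add: euler_factor_Suc algebra_simps)
qed

definition small_step :: "nat \<Rightarrow> nat \<Rightarrow> real \<Rightarrow> bool" where
  "small_step k p r \<longleftrightarrow> 1 + 1 / real p powr r \<le> dsum (rough k p) r"

text \<open>If the full factor fits below \<open>x\<close>, it leaves at most \<open>T\<close>.  Otherwise the largest partial factor below
  \<open>x\<close> misses \<open>x\<close> by a ratio of at most \<open>1 + 1 / p powr r\<close>, which again is at most \<open>T\<close>.\<close>

lemma greedy_digit:
  assumes "p > 0" "r > 0" and T: "1 + 1 / real p powr r \<le> T"
    and x: "1 \<le> x" "x \<le> euler_factor k p r * T"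
  shows "\<exists>j\<le>k. 1 \<le> x / euler_factor j p r \<and> x / euler_factor j p r \<le> T"
proof -
  have pos: "euler_factor j p r > 0" for j
    using euler_factor_ge_1[OF assms(1), of j r] by simp
  have div: "x / euler_factor j p r \<le> T" if "x \<le> euler_factor j p r * T" for j
    using pos[of j] that by (simp add: pos_divide_le_eq mult.commute)
  show ?thesis
  proof (cases "euler_factor k p r \<le> x")
    case True
    thus ?thesis using div[OF x(2)] pos[of k] by auto
  next
    case False
    \<comment> \<open>pick the first digit at which the partial Euler factor overshoots\<close>
    define j where "j = (LEAST j. x < euler_factor j p r)"
    have j: "x < euler_factor j p r"
      unfolding j_def by (rule LeastI[of _ k]) (use False in simp)
    have "j \<noteq> 0" using j x(1) assms(1) by (auto simp: euler_factor_0 intro!: Nat.gr0I)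
    then obtain i where i: "j = Suc i" by (cases j) auto
    have le: "euler_factor i p r \<le> x"
      using not_less_Least[of i "\<lambda>j. x < euler_factor j p r"] i j_def by simp
    have "j \<le> k" unfolding j_def by (rule Least_le) (use False in simp)
    moreover have "x \<le> euler_factor i p r * T"
    proof -
      have "(1 + 1 / real p powr r) * euler_factor i p r \<le> T * euler_factor i p r"
        using pos[of i] T by (intro mult_right_mono) auto
      thus ?thesis
        using j i euler_factor_Suc_le[OF assms(1,2), of i] by (simp only: mult.commute)
    qed
    ultimately show ?thesis using le div[of i] pos[of i] i by (intro exI[of _ i]) auto
  qed
qed

text \<open>The invariant of the greedy algorithm: what is left of the target after the primes up to \<open>y\<close>
  lies between 1 and the tail of the Euler product beyond \<open>y\<close>.\<close>

lemma greedy_approximation: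
  assumes r: "r > 1"
    and C: "\<And>p. prime p \<Longrightarrow> small_step k p r"
    and x: "1 \<le> x" "x \<le> dsum (power_free k) r"
  shows "\<exists>n\<in>power_free k. (\<forall>p. prime p \<longrightarrow> p dvd n \<longrightarrow> p \<le> y) \<and>
           1 \<le> x / divisor_sigma (- r) n \<and> x / divisor_sigma (- r) n \<le> dsum (rough k y) r"
proof (induction y)
  case 0
  have "divisor_sigma (- r) 1 = 1" by (simp add: divisor_sigma_eq_dsum dsum_finite)
  thus ?case using x
    by (intro bexI[of _ 1]) (auto simp: rough_0 power_free_iff_multiplicity)
next
  case (Suc y)
  then obtain n where n: "n \<in> power_free k" "\<forall>p. prime p \<longrightarrow> p dvd n \<longrightarrow> p \<le> y"
      "1 \<le> x / divisor_sigma (- r) n" "x / divisor_sigma (- r) n \<le> dsum (rough k y) r"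
    by blast
  show ?case
  proof (cases "prime (Suc y)")
    case False
    thus ?thesis using n by (intro bexI[of _ n]) (auto simp: rough_nonprime)
  next
    case p: True
    let ?p = "Suc y"
    have n0: "n > 0" using n(1) by (simp add: power_free_def)
    have ndvd: "\<not> ?p dvd n" using n(2) p by auto
    have "dsum (rough k y) r = euler_factor k ?p r * dsum (rough k ?p) r"
      using dsum_rough_prime[OF p r, of k] by simp
    then obtain j where j: "j \<le> k"
        "1 \<le> x / divisor_sigma (- r) n / euler_factor j ?p r"
        "x / divisor_sigma (- r) n / euler_factor j ?p r \<le> dsum (rough k ?p) r"
      using greedy_digit[of ?p r "dsum (rough k ?p) r" "x / divisor_sigma (- r) n" k]
        r C[OF p, unfolded small_step_def] n(3,4)
      by auto
    have "multiplicity q (?p ^ j * n) \<le> k" if q: "prime q" for q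
    proof (cases "q = ?p")
      case True
      have "multiplicity ?p (?p ^ j * n) = j"
        by (rule multiplicity_decomposeI[OF refl ndvd]) simp
      thus ?thesis using True j(1) by simp
    next
      case False
      have "multiplicity q (?p ^ j * n) = multiplicity q n"
        using multiplicity_power_times[OF q _ n0, of ?p j] False p q
        by (simp add: prime_multiplicity_other)
      thus ?thesis using n(1) q by (simp add: power_free_iff_multiplicity)
    qed
    hence "?p ^ j * n \<in> power_free k"
      using n0 by (simp add: power_free_iff_multiplicity)
    moreover have "q \<le> Suc y" if "prime q" "q dvd ?p ^ j * n" for q
    proof -
      from that have "q dvd ?p ^ j \<or> q dvd n" by (simp add: prime_dvd_mult_iff)
      thus ?thesis
      proof
        assume "q dvd ?p ^ j"
        hence "q = ?p" using primes_dvd_imp_eq[OF that(1) p] prime_dvd_power[OF that(1)] by blast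
        thus ?thesis by simp
      next
        assume "q dvd n"
        thus ?thesis using n(2) that(1) le_SucI by blast
      qed
    qed
    moreover have "x / divisor_sigma (- r) (?p ^ j * n)
        = x / divisor_sigma (- r) n / euler_factor j ?p r"
      using divisor_sigma_prime_power_times[OF p ndvd r, of j] by (simp add: mult.commute)
    ultimately show ?thesis using j by (intro bexI[of _ "?p ^ j * n"]) auto
  qed
qed

text \<open>A rough number other than 1 exceeds \<open>y\<close>, so the rest of the sum is bounded by a tail of a
  convergent series.\<close>

lemma dsum_rough_tendsto_1:
  assumes r: "r > 1"
  shows "(\<lambda>y. dsum (rough k y) r) \<longlonglongrightarrow> 1"
proof -
  let ?f = "\<lambda>n. real n powr - r"
  have "(?f has_sum dsum UNIV r) UNIV"
    using dsum_summable[OF r] unfolding dsum_def by (rule has_sum_infsum)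
  hence "(\<lambda>y. sum ?f {..y}) \<longlonglongrightarrow> dsum UNIV r"
    using has_sum_imp_sums unfolding sums_def_le by blast
  hence "(\<lambda>y. 1 + (dsum UNIV r - sum ?f {..y})) \<longlonglongrightarrow> 1 + (dsum UNIV r - dsum UNIV r)"
    by (intro tendsto_intros)
  hence lim: "(\<lambda>y. 1 + (dsum UNIV r - sum ?f {..y})) \<longlonglongrightarrow> 1" by simp
  have upper: "dsum (rough k y) r \<le> 1 + (dsum UNIV r - sum ?f {..y})" for y
  proof -
    have "rough k y \<subseteq> {1} \<union> {y<..}" using rough_gt by auto
    hence "dsum (rough k y) r \<le> dsum ({1} \<union> {y<..}) r" by (rule dsum_mono[OF r])
    also have "\<dots> \<le> 1 + dsum {y<..} r"
    proof (cases "1 \<in> {y<..}")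
      case True
      hence "{1} \<union> {y<..} = {y<..}" by auto
      thus ?thesis by simp
    qed (use dsum_Un_disjoint[OF r, of "{1}" "{y<..}"] in \<open>auto simp: dsum_finite\<close>)
    also have "dsum UNIV r = dsum {..y} r + dsum {y<..} r"
    proof -
      have "{..y} \<union> {y<..} = (UNIV :: nat set)" by auto
      moreover have "{..y} \<inter> {y<..} = {}" by auto
      ultimately show ?thesis using dsum_Un_disjoint[OF r, of "{..y}" "{y<..}"] by simp
    qed
    hence "1 + dsum {y<..} r = 1 + (dsum UNIV r - sum ?f {..y})"
      by (simp add: dsum_finite)
    finally show ?thesis .
  qed
  have "1 \<le> dsum (rough k y) r" for y
    using dsum_mono[OF r, of "{1}" "rough k y"] one_in_rough by (simp add: dsum_finite)
  thus ?thesis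
    using upper by (intro tendsto_sandwich[OF _ _ tendsto_const lim]) auto
qed

lemma dense_if_small_steps:
  assumes r: "r > 1"
    and C: "\<And>p. prime p \<Longrightarrow> small_step k p r"
  shows "{1..<dsum (power_free k) r} \<subseteq> closure (divisor_sigma (- r) ` power_free k)"
proof
  fix x assume "x \<in> {1..<dsum (power_free k) r}"
  hence x: "1 \<le> x" "x \<le> dsum (power_free k) r" by auto
  obtain f where f: "\<And>y. f y \<in> power_free k" "\<And>y. 1 \<le> x / divisor_sigma (- r) (f y)"
      "\<And>y. x / divisor_sigma (- r) (f y) \<le> dsum (rough k y) r"
    using greedy_approximation[OF r C x] by metis
  have "(\<lambda>y. x / divisor_sigma (- r) (f y)) \<longlonglongrightarrow> 1"
    by (rule tendsto_sandwich[OF _ _ tendsto_const dsum_rough_tendsto_1[OF r, of k]]) (use f in auto)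
  hence "(\<lambda>y. x / (x / divisor_sigma (- r) (f y))) \<longlonglongrightarrow> x / 1"
    by (intro tendsto_intros) auto
  hence "(\<lambda>y. divisor_sigma (- r) (f y)) \<longlonglongrightarrow> x" using x by simp
  thus "x \<in> closure (divisor_sigma (- r) ` power_free k)"
    unfolding closure_sequential
    using f(1) by (intro exI[of _ "\<lambda>y. divisor_sigma (- r) (f y)"]) auto
qed

text \<open>Any value of a number with a prime factor \<open>q \<le> p\<close> is at least \<open>1 + 1 / q powr r\<close>, and the divisors of
  any other power-free number are \<open>p\<close>-rough.  A failing inequality therefore opens a gap in the range.\<close>

lemma small_steps_if_dense:
  assumes r: "r > 1" and k: "k > 0" and p: "prime p"
    and dense: "{1..<dsum (power_free k) r} \<subseteq> closure (divisor_sigma (- r) ` power_free k)"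
  shows "small_step k p r"
proof (rule ccontr)
  let ?T = "dsum (rough k p) r" and ?Z = "dsum (power_free k) r"
  assume "\<not> small_step k p r"
  hence less: "?T < 1 + 1 / real p powr r" by (simp add: small_step_def)
  have T1: "1 \<le> ?T"
    using dsum_mono[OF r, of "{1}" "rough k p"] one_in_rough by (simp add: dsum_finite)
  have p0: "p > 0" using p prime_gt_0_nat by blast
  have "?T + 1 / real p powr r = dsum (rough k p \<union> {p}) r"
    using not_dvd_rough[OF p, of p k]
    by (subst dsum_Un_disjoint[OF r]) (auto simp: dsum_finite powr_minus_divide)
  also have "\<dots> \<le> ?Z"
    using prime_in_rough[OF p p0 k] by (intro dsum_mono[OF r]) (auto simp: rough_def)
  finally have TZ: "?T < ?Z"
    using p0 by (smt (verit) divide_pos_pos powr_gt_zero of_nat_0_less_iff)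
  let ?G = "{?T<..<1 + 1 / real p powr r}"
  have gap: "divisor_sigma (- r) n \<notin> ?G" if n: "n \<in> power_free k" for n
  proof (cases "n \<in> rough k p")
    case True
    hence "{d. d dvd n} \<subseteq> rough k p" using dvd_in_rough by blast
    hence "divisor_sigma (- r) n \<le> ?T"
      using n by (subst divisor_sigma_eq_dsum) (auto intro: dsum_mono[OF r] simp: power_free_def)
    thus ?thesis by simp
  next
    case False
    then obtain q where q: "prime q" "q dvd n" "q \<le> p"
      using n by (auto simp: rough_def)
    have q1: "q > 1" using q(1) prime_gt_1_nat by blast
    have "real q powr r \<le> real p powr r" using q(3) r by (intro powr_mono2) auto
    hence "1 / real p powr r \<le> 1 / real q powr r"
      using q1 p0 by (intro divide_left_mono) auto
    hence "1 + 1 / real p powr r \<le> 1 + 1 / real q powr r" by simp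
    also have "\<dots> = dsum {1, q} r"
      using q1 by (simp add: dsum_finite powr_minus_divide)
    also have "\<dots> \<le> divisor_sigma (- r) n"
      using n q(2) by (subst divisor_sigma_eq_dsum) (auto intro!: dsum_mono[OF r] simp: power_free_def)
    finally show ?thesis by simp
  qed
  \<comment> \<open>the gap meets the interval in question, as the tail is smaller than the full product\<close>
  define x where "x = (?T + min ?Z (1 + 1 / real p powr r)) / 2"
  have x: "?T < x" "x < ?Z" "x < 1 + 1 / real p powr r"
    using less TZ unfolding x_def by (auto simp: min_def)
  hence "x \<in> closure (divisor_sigma (- r) ` power_free k)"
    using dense T1 by auto
  hence "?G \<inter> divisor_sigma (- r) ` power_free k \<noteq> {}"
    using x open_Int_closure_eq_empty[OF open_greaterThanLessThan]
    by (metis IntI empty_iff greaterThanLessThan_iff)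
  with gap show False by blast
qed

section \<open>Monotonicity in the exponent\<close>

lemma dsum_rough_minus_one:
  assumes "r > 1"
  shows "dsum (rough k y) r = 1 + dsum (rough k y - {1}) r"
proof -
  have "rough k y = {1} \<union> (rough k y - {1})" using one_in_rough by auto
  hence "dsum (rough k y) r = dsum ({1} \<union> (rough k y - {1})) r" by simp
  also have "\<dots> = 1 + dsum (rough k y - {1}) r"
    using assms by (subst dsum_Un_disjoint) (auto simp: dsum_finite)
  finally show ?thesis .
qed

text \<open>Rough numbers other than 1 are at least \<open>p + 1\<close>, so passing from \<open>s\<close> down to \<open>r\<close> multiplies each
  term of the tail by at least \<open>(p + 1) powr (s - r)\<close>, but the left side only by \<open>p powr (s - r)\<close>.\<close>

lemma small_step_antimono_strict:
  assumes p: "p > 0" and r: "1 < r" "r < s" and step: "small_step k p s"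
  shows "1 + 1 / real p powr r < dsum (rough k p) r"
proof -
  let ?R = "rough k p - {1}"
  have s: "s > 1" using r by simp
  have le: "1 / real p powr s \<le> dsum ?R s"
    using step dsum_rough_minus_one[OF s, of k p] by (simp add: small_step_def)
  have "1 / real p powr r = real p powr (s - r) * (1 / real p powr s)"
    using p by (simp add: powr_diff)
  also have "\<dots> < real (p + 1) powr (s - r) * (1 / real p powr s)"
    using p r by (intro mult_strict_right_mono powr_less_mono2) auto
  also have "\<dots> \<le> real (p + 1) powr (s - r) * dsum ?R s"
    using le by (intro mult_left_mono) auto
  also have "\<dots> = (\<Sum>\<^sub>\<infinity>n\<in>?R. real (p + 1) powr (s - r) * real n powr - s)"
    by (simp only: dsum_def infsum_cmult_right')
  also have "\<dots> \<le> dsum ?R r"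
    unfolding dsum_def
  proof (rule infsum_mono)
    fix n assume "n \<in> ?R"
    hence n: "n \<ge> p + 1" using rough_gt[of n k p] by auto
    have "real (p + 1) powr (s - r) * real n powr - s \<le> real n powr (s - r) * real n powr - s"
      using n r by (intro mult_right_mono powr_mono2) auto
    also have "\<dots> = real n powr - r" by (simp flip: powr_add)
    finally show "real (p + 1) powr (s - r) * real n powr - s \<le> real n powr - r" .
  qed (use dsum_summable r s in \<open>auto intro: summable_on_cmult_right\<close>)
  finally show ?thesis using dsum_rough_minus_one[OF r(1), of k p] by simp
qed

lemma small_step_antimono:
  assumes "p > 0" "1 < r" "r \<le> s" "small_step k p s"
  shows "small_step k p r"
  using small_step_antimono_strict[of p r s k] assms by (cases "r = s") (auto simp: small_step_def)

text \<open>The terms at the left end point of the interval are a summable majorant.\<close>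

lemma continuous_on_dsum:
  assumes a: "1 < a"
  shows "continuous_on {a..b} (dsum A)"
proof -
  have "uniform_limit {a..b} (\<lambda>X s. \<Sum>n\<in>X. real n powr - s) (\<lambda>s. \<Sum>\<^sub>\<infinity>n\<in>A. real n powr - s)
          (finite_subsets_at_top A)"
  proof (rule Weierstrass_m_test_general)
    fix n :: nat and s :: real assume "s \<in> {a..b}"
    thus "norm (real n powr - s) \<le> real n powr - a"
      using a by (cases "n = 0") (auto intro!: powr_mono)
  qed (rule dsum_summable[OF a])
  moreover have "continuous_on {a..b} (\<lambda>s. \<Sum>n\<in>X. real n powr - s)" for X :: "nat set"
  proof (intro continuous_on_sum)
    fix n :: nat
    show "continuous_on {a..b} (\<lambda>s. real n powr - s)"
      by (cases "n = 0") (auto intro!: continuous_intros)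
  qed
  ultimately have "continuous_on {a..b} (\<lambda>s. \<Sum>\<^sub>\<infinity>n\<in>A. real n powr - s)"
    by (intro uniform_limit_theorem[where F = "finite_subsets_at_top A"]) auto
  thus ?thesis by (simp add: dsum_def[abs_def])
qed

text \<open>The intermediate value theorem gives a point of equality, and strict monotonicity makes it unique
  and puts it at the boundary between the exponents with and without a small step.\<close>

lemma small_step_threshold:
  assumes p: "p > 0" and ab: "1 < a" "a < b" "b \<le> 2"
    and a: "small_step k p a" and b: "\<not> small_step k p b"
  defines "e \<equiv> (THE x. 1 < x \<and> x < 2 \<and> dsum (rough k p) x = 1 + 1 / real p powr x)"
  shows "a \<le> e" "e < b" "\<And>r. r > 1 \<Longrightarrow> small_step k p r \<longleftrightarrow> r \<le> e"
proof -
  let ?h = "\<lambda>x. dsum (rough k p) x - (1 + 1 / real p powr x)"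
  have "continuous_on {a..b} ?h"
    using p by (intro continuous_intros continuous_on_dsum ab) auto
  moreover have "?h b \<le> 0" "0 \<le> ?h a" using a b by (auto simp: small_step_def)
  ultimately obtain x where x: "a \<le> x" "x \<le> b" "?h x = 0"
    using IVT2'[of ?h b 0 a] ab by auto
  have xb: "x \<noteq> b" using x b by (auto simp: small_step_def)
  have unique: "y = x" if "1 < y" "?h y = 0" for y
    using small_step_antimono_strict[OF p, of x y k] small_step_antimono_strict[OF p, of y x k] x that ab
    by (cases x y rule: linorder_cases) (auto simp: small_step_def)
  have e: "e = x"
    unfolding e_def by (rule the_equality) (use x xb ab unique in auto)
  show "a \<le> e" "e < b" using x xb by (auto simp: e)
  show "small_step k p r \<longleftrightarrow> r \<le> e" if r: "r > 1" for r
  proof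
    assume "r \<le> e"
    moreover have "small_step k p e" using x by (simp add: small_step_def e)
    ultimately show "small_step k p r" using small_step_antimono[OF p r] by blast
  next
    assume "small_step k p r"
    thus "r \<le> e"
      using small_step_antimono_strict[OF p, of e r k] x ab e by (cases "r \<le> e") auto
  qed
qed

section \<open>Inverse squares of primes\<close>

text \<open>The reciprocals of \<open>j * (n choose j)\<close> are the entries of the Leibniz harmonic triangle, in which
  each entry is a difference of entries closer to the edge and the edge consists of the numbers
  \<open>1 / n\<close>.  Hence \<open>L\<close> times any entry is an integer.\<close>

lemma common_multiple_binomial:
  assumes L: "\<And>i. 1 \<le> i \<Longrightarrow> i \<le> N \<Longrightarrow> i dvd L" and "1 \<le> j" "j \<le> n" "n \<le> N"
  shows "j * (n choose j) dvd L"
proof -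
  have "real L / real (j * (n choose j)) \<in> \<int>"
    using assms(2-4)
  proof (induction "n - j" arbitrary: n j)
    case 0
    hence "j = n" by simp
    moreover from L[of n] 0 obtain c where "L = n * c" by auto
    ultimately show ?case using 0 by simp
  next
    case (Suc d)
    let ?C = "real (n choose j)"
    have jn: "j < n" using Suc.hyps(2) by simp
    have C: "?C > 0" using jn by simp
    have "(n - j) * (n choose j) = n * (n - 1 choose j)"
      by (rule binomial_absorb_comp)
    hence "real (n - j) * ?C = real n * real (n - 1 choose j)"
      by (metis of_nat_mult)
    hence e1: "real (n - 1 choose j) = (real n - real j) * ?C / real n"
      using jn by (simp add: field_simps of_nat_diff)
    have "Suc j * (n choose Suc j) = n * (n - 1 choose j)"
      by (rule binomial_absorption)
    with binomial_absorb_comp[of n j] have "Suc j * (n choose Suc j) = (n - j) * (n choose j)"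
      by simp
    hence "real (Suc j * (n choose Suc j)) = real (n - j) * ?C"
      by (metis of_nat_mult)
    hence e2: "real (Suc j * (n choose Suc j)) = (real n - real j) * ?C"
      using jn by (simp only: of_nat_diff less_imp_le)
    have e3: "real (j * (n - 1 choose j)) = real j * ((real n - real j) * ?C / real n)"
      by (simp only: of_nat_mult e1)
    have d: "real n - real j > 0" "real j > 0" "real n > 0" using jn Suc.prems by auto
    \<comment> \<open>the defining recurrence of the Leibniz harmonic triangle\<close>
    have "real L / (real j * ?C)
        = real L / (real j * ((real n - real j) * ?C / real n)) - real L / ((real n - real j) * ?C)"
    proof -
      have "l / (a * c) = l / (a * (e * c / n')) - l / (e * c)"
        if "n' = a + e" "a > 0" "e > 0" "c > 0" for l a e c n' :: real
        using that by (simp add: field_simps)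
      from this[of "real n" "real j" "real n - real j" ?C] d C show ?thesis by simp
    qed
    hence "real L / real (j * (n choose j))
        = real L / real (j * (n - 1 choose j)) - real L / real (Suc j * (n choose Suc j))"
      by (simp only: e2 e3) simp
    moreover have "real L / real (j * (n - 1 choose j)) \<in> \<int>"
      using Suc.hyps(2) Suc.prems jn by (intro Suc.hyps(1)) auto
    moreover have "real L / real (Suc j * (n choose Suc j)) \<in> \<int>"
      using Suc.hyps(2) Suc.prems jn by (intro Suc.hyps(1)) auto
    ultimately show ?case by simp
  qed
  then obtain z where z: "real L / real (j * (n choose j)) = of_int z" by (auto elim: Ints_cases)
  have pos: "j * (n choose j) > 0" using assms by simp
  have "real L = of_int z * real (j * (n choose j))"
    using z pos by (simp add: field_simps)
  hence "int L = z * int (j * (n choose j))"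
    by (metis of_int_eq_iff of_int_mult of_int_of_nat_eq)
  hence "int (j * (n choose j)) dvd int L" by simp
  thus ?thesis by (simp only: int_dvd_int_iff)
qed

text \<open>The witness is the product over the primes up to \<open>N\<close> of their largest powers up to \<open>N\<close>.\<close>

lemma common_multiple_le_power_primes:
  fixes N :: nat
  assumes "N > 0"
  shows "\<exists>L>0. (\<forall>i. 1 \<le> i \<longrightarrow> i \<le> N \<longrightarrow> i dvd L) \<and> L \<le> N ^ card {p. prime p \<and> p \<le> N}"
proof -
  let ?P = "{p. prime p \<and> p \<le> N}"
  define e where "e p = Max {a\<in>{..N}. p ^ a \<le> N}" for p :: nat
  define L where "L = (\<Prod>p\<in>?P. p ^ e p)"
  have fin: "finite ?P" by (rule finite_subset[of _ "{..N}"]) auto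
  have e_in: "e p \<in> {a\<in>{..N}. p ^ a \<le> N}" for p
    unfolding e_def by (rule Max_in) (use assms in \<open>auto intro!: exI[of _ 0]\<close>)
  have e_max: "a \<le> e p" if "prime p" "p ^ a \<le> N" for a p
  proof -
    have "a < p ^ a" by (rule power_gt_expt) (use prime_gt_1_nat[OF that(1)] in simp)
    thus ?thesis unfolding e_def using that(2) by (intro Max_ge) auto
  qed
  have "L > 0" unfolding L_def by (rule prod_pos) (auto simp: prime_gt_0_nat)
  moreover have "i dvd L" if i: "1 \<le> i" "i \<le> N" for i
  proof (rule multiplicity_le_imp_dvd)
    show "i \<noteq> 0" using i by simp
    fix p :: nat assume p: "prime p"
    have "p ^ multiplicity p i dvd i" by (rule multiplicity_dvd)
    hence le: "p ^ multiplicity p i \<le> N"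
      using dvd_imp_le[of _ i] i by (meson le_trans less_le_trans zero_less_one)
    show "multiplicity p i \<le> multiplicity p L"
    proof (cases "p dvd i")
      case False
      thus ?thesis by (simp add: not_dvd_imp_multiplicity_0)
    next
      case True
      hence "p \<in> ?P" using i p dvd_imp_le[of p i] by auto
      hence "multiplicity p L = e p"
        unfolding L_def using fin p by (subst multiplicity_prod_prime_powers) auto
      thus ?thesis using e_max[OF p le] by simp
    qed
  qed
  moreover have "L \<le> (\<Prod>p\<in>?P. N)"
    unfolding L_def using e_in by (intro prod_mono) auto
  hence "L \<le> N ^ card ?P" by simp
  ultimately show ?thesis by blast
qed

text \<open>A Chebyshev-type lower bound for the number of primes up to \<open>2 * n\<close>, from the central binomial
  coefficient.\<close>

lemma four_power_le_power_primes:
  assumes "n > 0"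
  shows "4 ^ n \<le> (2 * n) ^ Suc (card {p. prime p \<and> p \<le> 2 * n})"
proof -
  obtain L where L: "L > 0" "\<And>i. 1 \<le> i \<Longrightarrow> i \<le> 2 * n \<Longrightarrow> i dvd L"
      "L \<le> (2 * n) ^ card {p. prime p \<and> p \<le> 2 * n}"
    using common_multiple_le_power_primes[of "2 * n"] assms by auto
  have "n * ((2 * n) choose n) dvd L"
    by (rule common_multiple_binomial[of "2 * n"]) (use L(2) assms in auto)
  hence le: "n * ((2 * n) choose n) \<le> L" using L(1) by (rule dvd_imp_le)
  have "real (4 ^ n) \<le> real (2 * n * ((2 * n) choose n))"
    using central_binomial_lower_bound[OF assms] assms by (simp add: field_simps)
  hence "4 ^ n \<le> 2 * (n * ((2 * n) choose n))" by (simp only: of_nat_le_iff mult.assoc)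
  also have "\<dots> \<le> (2 * n) * L" using le assms by (intro mult_mono) auto
  also have "\<dots> \<le> (2 * n) * (2 * n) ^ card {p. prime p \<and> p \<le> 2 * n}"
    using L(3) by (rule mult_left_mono) simp
  finally show ?thesis by simp
qed

text \<open>Apart from 2 the primes are odd numbers greater than 1.\<close>

lemma card_primes_le:
  assumes "q > 0"
  shows "2 * card {p. prime p \<and> p \<le> q} \<le> q + 1"
proof -
  have "{p. prime p \<and> p \<le> q} \<subseteq> insert 2 ((\<lambda>i. 2 * i + 1) ` {1..(q - 1) div 2})"
  proof clarify
    fix p assume p: "prime p" "p \<le> q"
      and notin: "p \<notin> (\<lambda>i. 2 * i + 1) ` {1..(q - 1) div 2}"
    show "p = 2"
    proof (rule ccontr)
      assume "p \<noteq> 2"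
      with prime_ge_2_nat[OF p(1)] have "p > 2" by linarith
      hence "odd p" by (rule prime_odd_nat[OF p(1)])
      then obtain i where "p = 2 * i + 1" by (rule oddE)
      with \<open>p > 2\<close> p(2) notin show False by auto
    qed
  qed
  hence "card {p. prime p \<and> p \<le> q} \<le> card (insert 2 ((\<lambda>i. 2 * i + 1) ` {1..(q - 1) div 2}))"
    by (rule card_mono[rotated]) simp
  also have "\<dots> \<le> Suc (card ((\<lambda>i. 2 * i + 1) ` {1..(q - 1) div 2}))"
    by (rule card_insert_le_m1) auto
  also have "\<dots> \<le> Suc ((q - 1) div 2)"
    using card_image_le[of "{1..(q - 1) div 2}" "\<lambda>i. 2 * i + 1"] by simp
  finally show ?thesis using assms by linarith
qed

text \<open>A finite set of larger primes already yields the required sum.  The exponent 2 is the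
  extreme case among the exponents up to 2, as the quotients \<open>q / b\<close> are below 1.\<close>

definition prime_squares_suffice :: "nat \<Rightarrow> bool" where
  "prime_squares_suffice q \<longleftrightarrow> (\<exists>B. finite B \<and> (\<forall>b\<in>B. prime b \<and> b > q) \<and>
     1 / real q ^ 2 \<le> (\<Sum>b\<in>B. 1 / real b ^ 2))"

lemma cubic_le_four_power: "c \<ge> 7 \<Longrightarrow> 16 * c * (c + 1) ^ 2 \<le> (4::nat) ^ c"
proof (induction c rule: nat_induct_at_least)
  case (Suc c)
  have "Suc c * (Suc c + 1) ^ 2 \<le> (2 * c) * (2 * (c + 1) ^ 2)"
  proof (rule mult_mono)
    have "1 * 2 \<le> c * c" using Suc.hyps by (intro mult_mono) auto
    thus "(Suc c + 1) ^ 2 \<le> 2 * (c + 1) ^ 2"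
      using Suc.hyps by (simp add: power2_eq_square algebra_simps)
  qed (use Suc.hyps in auto)
  also have "\<dots> = 4 * (c * (c + 1) ^ 2)" by (simp add: algebra_simps)
  finally have "16 * (Suc c * (Suc c + 1) ^ 2) \<le> 16 * (4 * (c * (c + 1) ^ 2))"
    by (rule mult_left_mono) simp
  also have "\<dots> = 4 * (16 * c * (c + 1) ^ 2)" by simp
  also have "\<dots> \<le> 4 * 4 ^ c" using Suc.IH by simp
  finally show ?case by (simp only: mult.assoc power_Suc)
qed simp

text \<open>For \<open>q\<close> near \<open>8 * c\<^sup>2\<close> consider the primes between \<open>q\<close> and \<open>N = 2 * c * q\<close>.  Each of them contributes
  at least \<open>1 / N\<^sup>2\<close>, so \<open>4 * c\<^sup>2\<close> of them suffice.  If there were fewer, the trivial bound for the primes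
  up to \<open>q\<close> would leave at most \<open>q - 1\<close> primes up to \<open>N\<close>, and \<open>4 ^ (c * q) \<le> N ^ q\<close> would follow, although
  \<open>N < 4 ^ c\<close>.  The last inequality holds for \<open>c \<ge> 7\<close>, that is for \<open>q \<ge> 392\<close>.\<close>

lemma prime_squares_suffice_large:
  assumes q: "q \<ge> 392"
  shows "prime_squares_suffice q"
proof -
  define m where "m = (LEAST m. q < 8 * m ^ 2)"
  have "q < 8 * q ^ 2" using q by (simp add: power2_eq_square)
  hence m: "q < 8 * m ^ 2" unfolding m_def by (rule LeastI)
  have m8: "8 \<le> m"
  proof (rule ccontr)
    assume "\<not> 8 \<le> m"
    hence "m ^ 2 \<le> 7 ^ 2" by (intro power_mono) auto
    with m q show False by simp
  qed
  define c where "c = m - 1"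
  have c: "c \<ge> 7" "8 * c ^ 2 \<le> q" "q < 8 * (c + 1) ^ 2"
    using m m8 not_less_Least[of c "\<lambda>m. q < 8 * m ^ 2"] by (auto simp: c_def m_def)
  define N where "N = 2 * (c * q)"
  define B where "B = {b. prime b \<and> q < b \<and> b \<le> N}"
  have finB: "finite B" unfolding B_def by (rule finite_subset[of _ "{..N}"]) auto
  have q0: "q > 0" "c > 0" using q c by auto
  have card: "4 * c ^ 2 \<le> card B"
  proof (rule ccontr)
    assume "\<not> 4 * c ^ 2 \<le> card B"
    hence cB: "card B + 1 \<le> 4 * c ^ 2" by simp
    have "{p. prime p \<and> p \<le> N} \<subseteq> {p. prime p \<and> p \<le> q} \<union> B"
      by (auto simp: B_def)
    hence "card {p. prime p \<and> p \<le> N} \<le> card ({p. prime p \<and> p \<le> q} \<union> B)"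
      using finB by (intro card_mono) auto
    also have "\<dots> \<le> card {p. prime p \<and> p \<le> q} + card B" by (rule card_Un_le)
    \<comment> \<open>the primes up to \<open>q\<close> and those in \<open>B\<close> account for about \<open>q / 2\<close> each\<close>
    finally have "Suc (card {p. prime p \<and> p \<le> N}) \<le> q"
      using card_primes_le[OF q0(1)] cB c(2) by linarith
    hence "N ^ Suc (card {p. prime p \<and> p \<le> N}) \<le> N ^ q"
      using q0 by (intro power_increasing) (auto simp: N_def Suc_le_eq)
    hence "4 ^ (c * q) \<le> N ^ q"
      using four_power_le_power_primes[of "c * q"] q0 unfolding N_def by (auto intro: le_trans)
    moreover have "N < 4 ^ c"
    proof -
      have "N < 2 * (c * (8 * (c + 1) ^ 2))" unfolding N_def using c(3) q0 by simp
      also have "\<dots> \<le> 4 ^ c" using cubic_le_four_power[OF c(1)] by (simp add: mult.assoc mult.left_commute)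
      finally show ?thesis .
    qed
    hence "N ^ q < (4 ^ c) ^ q" using q0 by (intro power_strict_mono) auto
    ultimately show False by (simp add: power_mult)
  qed
  have bound: "1 / real N ^ 2 \<le> 1 / real b ^ 2" if "b \<in> B" for b
    using that by (intro divide_left_mono power_mono) (auto simp: B_def)
  have "1 / real q ^ 2 = real (4 * c ^ 2) * (1 / real N ^ 2)"
    using q0 by (simp add: N_def field_simps power2_eq_square)
  also have "\<dots> \<le> real (card B) * (1 / real N ^ 2)"
    using card by (intro mult_right_mono) (simp_all only: of_nat_le_iff zero_le_divide_1_iff zero_le_power of_nat_0_le_iff)
  also have "\<dots> = (\<Sum>b\<in>B. 1 / real N ^ 2)" by simp
  also have "\<dots> \<le> (\<Sum>b\<in>B. 1 / real b ^ 2)" by (intro sum_mono bound)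
  finally show ?thesis
    unfolding prime_squares_suffice_def using finB by (intro exI[of _ B]) (auto simp: B_def)
qed

text \<open>If \<open>p\<close> is less than \<open>q\<close> times the square root of 2, the prime \<open>p\<close> itself contributes at least half of
  what \<open>q\<close> requires, and the primes beyond \<open>p\<close> contribute at least the other half.  The lower end
  \<open>c\<close> makes one numerical comparison serve all \<open>q\<close> from \<open>c\<close> up to \<open>p\<close>.\<close>

lemma prime_squares_suffice_step:
  assumes p: "prime p" "prime_squares_suffice p" and c: "0 < c" "p ^ 2 \<le> 2 * c ^ 2"
    and q: "c \<le> q" "q < p"
  shows "prime_squares_suffice q"
proof -
  obtain B where B: "finite B" "\<And>b. b \<in> B \<Longrightarrow> prime b \<and> b > p"
      "1 / real p ^ 2 \<le> (\<Sum>b\<in>B. 1 / real b ^ 2)"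
    using p(2) by (auto simp: prime_squares_suffice_def)
  have "c ^ 2 \<le> q ^ 2" using q(1) by (rule power_mono) simp
  hence "p ^ 2 \<le> 2 * q ^ 2" using c(2) by linarith
  hence "real (p ^ 2) \<le> real (2 * q ^ 2)" by (simp only: of_nat_le_iff)
  hence "1 / real q ^ 2 \<le> 1 / real p ^ 2 + 1 / real p ^ 2"
    using q c by (simp add: field_simps)
  also have "\<dots> \<le> (\<Sum>b\<in>insert p B. 1 / real b ^ 2)"
    using B by (subst sum.insert) auto
  finally show ?thesis
    unfolding prime_squares_suffice_def using B p q
    by (intro exI[of _ "insert p B"]) (auto dest: order.strict_trans)
qed

lemma prime_squares_suffice_extend:
  assumes "\<forall>q\<ge>p. prime_squares_suffice q" "prime p" "0 < c" "p ^ 2 \<le> 2 * c ^ 2"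
  shows "\<forall>q\<ge>c. prime_squares_suffice q"
  using assms prime_squares_suffice_step by (metis not_le_imp_less order_refl)

lemma prime_squares_suffice_ge_11: "\<forall>q\<ge>11. prime_squares_suffice q"
proof -
  have "\<forall>q\<ge>409. prime_squares_suffice q"
    using prime_squares_suffice_large by auto
  hence "\<forall>q\<ge>293. prime_squares_suffice q"
    by (rule prime_squares_suffice_extend) simp_all
  hence "\<forall>q\<ge>211. prime_squares_suffice q"
    by (rule prime_squares_suffice_extend) simp_all
  hence "\<forall>q\<ge>157. prime_squares_suffice q"
    by (rule prime_squares_suffice_extend) simp_all
  hence "\<forall>q\<ge>113. prime_squares_suffice q"
    by (rule prime_squares_suffice_extend) simp_all
  hence "\<forall>q\<ge>83. prime_squares_suffice q"
    by (rule prime_squares_suffice_extend) simp_all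
  hence "\<forall>q\<ge>59. prime_squares_suffice q"
    by (rule prime_squares_suffice_extend) simp_all
  hence "\<forall>q\<ge>43. prime_squares_suffice q"
    by (rule prime_squares_suffice_extend) simp_all
  hence "\<forall>q\<ge>31. prime_squares_suffice q"
    by (rule prime_squares_suffice_extend) simp_all
  hence "\<forall>q\<ge>23. prime_squares_suffice q"
    by (rule prime_squares_suffice_extend) simp_all
  hence "\<forall>q\<ge>17. prime_squares_suffice q"
    by (rule prime_squares_suffice_extend) simp_all
  hence "\<forall>q\<ge>13. prime_squares_suffice q"
    by (rule prime_squares_suffice_extend) simp_all
  hence "\<forall>q\<ge>11. prime_squares_suffice q"
    by (rule prime_squares_suffice_extend) simp_all
  thus ?thesis .
qed

text \<open>The next prime 11 is too far from 7 for the halving argument.  The primes 11, 13 and 17, together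
  with the primes beyond 17, suffice.\<close>

lemma prime_squares_suffice_7: "prime_squares_suffice 7"
proof -
  obtain B where B: "finite B" "\<And>b. b \<in> B \<Longrightarrow> prime b \<and> b > 17"
      "1 / real 17 ^ 2 \<le> (\<Sum>b\<in>B. 1 / real b ^ 2)"
    using prime_squares_suffice_ge_11[rule_format, of 17] by (auto simp: prime_squares_suffice_def)
  have notin: "11 \<notin> B" "13 \<notin> B" "17 \<notin> B" using B(2) by force+
  have "1 / real 7 ^ 2 \<le> 1 / real 11 ^ 2 + (1 / real 13 ^ 2 + (1 / real 17 ^ 2 + 1 / real 17 ^ 2))"
    by simp
  also have "\<dots> \<le> (\<Sum>b\<in>insert 11 (insert 13 (insert 17 B)). 1 / real b ^ 2)"
    using B(1,3) notin by simp
  finally show ?thesis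
    unfolding prime_squares_suffice_def using B(1,2)
    by (intro exI[of _ "insert 11 (insert 13 (insert 17 B))"]) fastforce
qed

lemma prime_squares_suffice_prime:
  assumes "prime p" "p \<ge> 5"
  shows "prime_squares_suffice p"
proof -
  have "prime_squares_suffice 5"
    by (rule prime_squares_suffice_step[OF _ prime_squares_suffice_7, of 5]) auto
  moreover have "p = 5 \<or> p = 7 \<or> p \<ge> 11"
  proof (rule ccontr)
    assume "\<not> ?thesis"
    hence "p = 6 \<or> p = 8 \<or> p = 9 \<or> p = 10" using assms(2) by auto
    thus False using assms(1) by auto
  qed
  ultimately show ?thesis
    using prime_squares_suffice_7 prime_squares_suffice_ge_11 by blast
qed

section \<open>Small steps at primes from five on\<close>

lemma small_step_if_primes:
  assumes r: "r > 1" and k: "k > 0" and B: "finite B" "\<And>b. b \<in> B \<Longrightarrow> prime b \<and> b > p"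
    and le: "1 / real p powr r \<le> (\<Sum>b\<in>B. 1 / real b powr r)"
  shows "small_step k p r"
proof -
  have "(\<Sum>b\<in>B. 1 / real b powr r) = dsum B r"
    using B(1) by (simp add: dsum_finite powr_minus_divide)
  also have "\<dots> \<le> dsum (rough k p - {1}) r"
    using B(2) prime_in_rough[of _ p k] k not_prime_1 by (intro dsum_mono[OF r]) blast
  finally show ?thesis
    using le dsum_rough_minus_one[OF r, of k p] by (simp add: small_step_def)
qed

text \<open>Lowering the exponent from 2 to \<open>r\<close> multiplies the term of \<open>b > p\<close> by \<open>b powr (2 - r)\<close>, which is
  at least the factor for \<open>p\<close>.\<close>

lemma small_step_large_prime:
  assumes r: "1 < r" "r \<le> 2" and k: "k > 0" and p: "prime p" "p \<ge> 5"
  shows "small_step k p r"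
proof -
  obtain B where B: "finite B" "\<And>b. b \<in> B \<Longrightarrow> prime b \<and> b > p"
      "1 / real p ^ 2 \<le> (\<Sum>b\<in>B. 1 / real b ^ 2)"
    using prime_squares_suffice_prime[OF p] by (auto simp: prime_squares_suffice_def)
  have p0: "p > 0" using p by simp
  have eq: "1 / real n powr r = real n powr (2 - r) * (1 / real n ^ 2)" if "n > 0" for n
    using that by (simp add: powr_diff)
  have "1 / real p powr r \<le> real p powr (2 - r) * (\<Sum>b\<in>B. 1 / real b ^ 2)"
    unfolding eq[OF p0] using B(3) by (intro mult_left_mono) auto
  also have "\<dots> = (\<Sum>b\<in>B. real p powr (2 - r) * (1 / real b ^ 2))"
    by (rule sum_distrib_left)
  also have "\<dots> \<le> (\<Sum>b\<in>B. 1 / real b powr r)"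
  proof (rule sum_mono)
    fix b assume "b \<in> B"
    hence b: "b > p" using B(2) by blast
    have "real p powr (2 - r) * (1 / real b ^ 2) \<le> real b powr (2 - r) * (1 / real b ^ 2)"
      using b r by (intro mult_right_mono powr_mono2) auto
    thus "real p powr (2 - r) * (1 / real b ^ 2) \<le> 1 / real b powr r"
      using eq[of b] b by simp
  qed
  finally show ?thesis by (intro small_step_if_primes[OF r(1) k B(1,2)])
qed

section \<open>Elementary bounds for zeta\<close>

text \<open>A convex function lies above its tangent at \<open>t\<close>.\<close>

lemma powr_minus_tangent:
  fixes x t a :: real
  assumes "x > 0" "t > 0" "a > 0"
  shows "t powr - a + a * t powr - (a + 1) * (t - x) \<le> x powr - a"
proof -
  have "1 + - a * (x / t - 1) \<le> 1 + - a * ln (x / t)"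
    using assms ln_le_minus_one[of "x / t"] by (intro add_left_mono mult_left_mono_neg) auto
  also have "\<dots> \<le> exp (- a * ln (x / t))" by (rule exp_ge_add_one_self)
  also have "\<dots> = (x / t) powr - a" using assms by (simp add: powr_def)
  finally have "t powr - a * (1 + - a * (x / t - 1)) \<le> t powr - a * (x / t) powr - a"
    by (intro mult_left_mono) auto
  also have "\<dots> = x powr - a"
    using assms by (simp flip: powr_mult)
  finally have "t powr - a + a * (t powr - a / t) * (t - x) \<le> x powr - a"
    using assms by (simp add: field_simps)
  moreover have "- (a + 1) = - a - 1" by simp
  hence "t powr - (a + 1) = t powr - a / t"
    using assms by (simp only: powr_diff) simp
  ultimately show ?thesis by simp
qed

lemma zeta_sums: "s > 1 \<Longrightarrow> (\<lambda>n. real (Suc n) powr - s) sums zeta s"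
proof -
  assume s: "s > 1"
  have "summable (\<lambda>n. real n powr - s)" using s by (simp add: summable_real_powr_iff)
  hence "summable (\<lambda>n. real (Suc n) powr - s)" by (subst summable_Suc_iff)
  thus ?thesis unfolding zeta_def by (simp add: sums_iff powr_minus_divide)
qed

text \<open>Comparison of the tail with an integral: the right side decreases in \<open>N\<close> and tends to \<open>zeta s\<close>.\<close>

lemma zeta_le:
  assumes s: "s > 1" and N: "N > 0"
  shows "zeta s \<le> (\<Sum>n=1..N. real n powr - s) + real N powr (1 - s) / (s - 1)"
proof -
  define v where "v m = (\<Sum>n=1..Suc m. real n powr - s) + real (Suc m) powr (1 - s) / (s - 1)" for m
  have "decseq v"
  proof (rule decseq_SucI)
    fix m
    have "(s - 1) * real (Suc (Suc m)) powr - s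
        \<le> real (Suc m) powr (1 - s) - real (Suc (Suc m)) powr (1 - s)"
      using powr_minus_tangent[of "real (Suc m)" "real (Suc (Suc m))" "s - 1"] s by simp
    hence "real (Suc (Suc m)) powr - s
        \<le> (real (Suc m) powr (1 - s) - real (Suc (Suc m)) powr (1 - s)) / (s - 1)"
      using s by (simp add: pos_le_divide_eq mult.commute)
    thus "v (Suc m) \<le> v m" by (simp add: v_def diff_divide_distrib)
  qed
  moreover have "v \<longlonglongrightarrow> zeta s"
  proof -
    have lim: "(\<lambda>m. \<Sum>n\<le>m. real (Suc n) powr - s) \<longlonglongrightarrow> zeta s"
      using zeta_sums[OF s] by (simp only: sums_def_le)
    have eq: "(\<Sum>n=1..Suc m. real n powr - s) = (\<Sum>n\<le>m. real (Suc n) powr - s)" for m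
      by (simp only: One_nat_def sum.shift_bounds_cl_Suc_ivl atMost_atLeast0)
    have "(\<lambda>m. real (Suc m) powr (1 - s) / (s - 1)) \<longlonglongrightarrow> 0"
      using s by real_asymp
    from tendsto_add[OF lim this] show ?thesis
      by (simp only: v_def[abs_def] eq add_0_right)
  qed
  ultimately have "zeta s \<le> v (N - 1)" by (rule decseq_ge)
  thus ?thesis using N by (simp add: v_def)
qed

text \<open>The trapezoidal rule overestimates the integral of a convex function, so the left side increases
  in \<open>N\<close>, again with limit \<open>zeta s\<close>.  The error is of order \<open>N powr (- s - 1)\<close>, one order better than
  for the comparison without the term \<open>N powr - s / 2\<close>.\<close>

lemma zeta_ge:
  assumes s: "s > 1" and N: "N > 0"
  shows "(\<Sum>n=1..<N. real n powr - s) + real N powr - s / 2 + real N powr (1 - s) / (s - 1) \<le> zeta s"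
proof -
  define u where "u m = (\<Sum>n=1..<Suc m. real n powr - s) + real (Suc m) powr - s / 2
      + real (Suc m) powr (1 - s) / (s - 1)" for m
  have "incseq u"
  proof (rule incseq_SucI)
    fix m
    let ?a = "real (Suc m)"
    define \<phi> where "\<phi> t = (?a powr - s + t powr - s) / 2 * (t - ?a) + t powr (1 - s) / (s - 1)" for t
    have "\<phi> ?a \<le> \<phi> (?a + 1)"
    proof (rule DERIV_nonneg_imp_nondecreasing[where f = \<phi>])
      fix t assume t: "?a \<le> t" "t \<le> ?a + 1"
      have t0: "t > 0" using t by simp
      have d: "((\<lambda>t. t powr - s) has_real_derivative - s * t powr (- s - 1)) (at t)"
        "((\<lambda>t. t powr (1 - s)) has_real_derivative (1 - s) * t powr (1 - s - 1)) (at t)"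
        "((\<lambda>t. t - ?a) has_real_derivative 1 - 0) (at t)"
        using t0 by (intro has_real_derivative_powr DERIV_diff DERIV_ident DERIV_const; simp)+
      have e: "t powr (- s - 1) = t powr (- 1 - s)" by (rule arg_cong) simp
      have "((\<lambda>t. (?a powr - s + t powr - s) / 2) has_real_derivative (0 + - s * t powr (- s - 1)) / 2) (at t)"
        by (intro DERIV_cdivide DERIV_add DERIV_const d)
      from DERIV_add[OF DERIV_mult[OF this d(3)] DERIV_cdivide[OF d(2), of "s - 1"]]
      have "(\<phi> has_real_derivative
          (?a powr - s - (t powr - s + s * t powr - (s + 1) * (t - ?a))) / 2) (at t)"
        unfolding \<phi>_def by (rule DERIV_cong) (use s in \<open>simp add: e field_simps\<close>)
      thus "\<exists>y. (\<phi> has_real_derivative y) (at t) \<and> 0 \<le> y"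
        using powr_minus_tangent[of ?a t s] t s by (intro exI conjI) auto
    qed simp
    hence trapezoid: "?a powr (1 - s) / (s - 1)
        \<le> ?a powr - s / 2 + (?a + 1) powr - s / 2 + (?a + 1) powr (1 - s) / (s - 1)"
      by (simp add: \<phi>_def add_divide_distrib)
    have sum: "(\<Sum>n=1..<Suc (Suc m). real n powr - s) = (\<Sum>n=1..<Suc m. real n powr - s) + ?a powr - s"
      by simp
    have suc: "real (Suc (Suc m)) = ?a + 1" by simp
    show "u m \<le> u (Suc m)"
      unfolding u_def sum suc using trapezoid by linarith
  qed
  moreover have "u \<longlonglongrightarrow> zeta s"
  proof -
    have lim: "(\<lambda>m. \<Sum>n<m. real (Suc n) powr - s) \<longlonglongrightarrow> zeta s"
      using zeta_sums[OF s] by (simp only: sums_def)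
    have eq: "(\<Sum>n=1..<Suc m. real n powr - s) = (\<Sum>n<m. real (Suc n) powr - s)" for m
      by (simp only: One_nat_def sum.shift_bounds_Suc_ivl lessThan_atLeast0)
    have "(\<lambda>m. real (Suc m) powr - s / 2) \<longlonglongrightarrow> 0"
      "(\<lambda>m. real (Suc m) powr (1 - s) / (s - 1)) \<longlonglongrightarrow> 0"
      using s by real_asymp+
    from tendsto_add[OF tendsto_add[OF lim this(1)] this(2)] show ?thesis
      by (simp only: u_def[abs_def] eq add_0_right)
  qed
  ultimately have "u (N - 1) \<le> zeta s" by (rule incseq_le)
  thus ?thesis using N by (simp add: u_def)
qed

section \<open>Rational powers of small integers\<close>

lemma powr_rational_power:
  fixes x :: real
  assumes "x > 0" "d > 0"
  shows "(x powr (real m / real d)) ^ d = x ^ m"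
proof -
  have "(x powr (real m / real d)) ^ d = x powr (real m / real d * real d)"
    using assms by (simp add: powr_powr flip: powr_realpow)
  also have "\<dots> = x ^ m" using assms by (simp add: powr_realpow)
  finally show ?thesis .
qed

lemma le_powr_rational:
  fixes x y :: real
  assumes "y ^ d \<le> x ^ m" "x > 0" "d > 0"
  shows "y \<le> x powr (real m / real d)"
proof -
  have "y ^ Suc (d - 1) \<le> (x powr (real m / real d)) ^ Suc (d - 1)"
    using assms by (simp only: powr_rational_power Suc_diff_1)
  thus ?thesis by (rule power_le_imp_le_base) simp
qed

lemma powr_rational_le:
  fixes x y :: real
  assumes "x ^ m \<le> y ^ d" "x > 0" "y \<ge> 0" "d > 0"
  shows "x powr (real m / real d) \<le> y"
proof -
  have "(x powr (real m / real d)) ^ Suc (d - 1) \<le> y ^ Suc (d - 1)"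
    using assms by (simp only: powr_rational_power Suc_diff_1)
  thus ?thesis using assms(3) by (rule power_le_imp_le_base)
qed

lemma powr_minus_rational_ge:
  assumes "lo ^ d * real n ^ m \<le> 1" "n > 0" "d > 0"
  shows "lo \<le> real n powr - (real m / real d)"
proof -
  have "lo ^ d \<le> (1 / real n) ^ m"
    using assms by (simp add: power_one_over field_simps)
  hence "lo \<le> (1 / real n) powr (real m / real d)"
    using assms by (intro le_powr_rational) auto
  thus ?thesis by (simp add: powr_divide powr_minus_divide)
qed

lemma powr_minus_rational_le:
  assumes "1 \<le> hi ^ d * real n ^ m" "n > 0" "d > 0" "hi \<ge> 0"
  shows "real n powr - (real m / real d) \<le> hi"
proof -
  have "(1 / real n) ^ m \<le> hi ^ d"
    using assms by (simp add: power_one_over field_simps)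
  hence "(1 / real n) powr (real m / real d) \<le> hi"
    using assms by (intro powr_rational_le) auto
  thus ?thesis by (simp add: powr_divide powr_minus_divide)
qed

lemma powr_one_minus: "x > 0 \<Longrightarrow> x powr (1 - s) = x * x powr - s" for x :: real
  by (simp add: powr_diff powr_minus_divide)

text \<open>One digit of the exponent in base 5: a bound for the exponent \<open>a\<close> gives one for \<open>(m + a) / 5\<close>.\<close>

lemma le_fifth_root_step:
  fixes x t u :: real
  assumes "t ^ 5 \<le> x ^ m * u" "u \<le> x powr a" "x > 0"
  shows "t \<le> x powr ((real m + a) / 5)"
proof -
  have "t ^ Suc 4 \<le> x ^ m * x powr a"
    using assms order.trans[OF assms(1) mult_left_mono[OF assms(2)]] by simp
  also have "\<dots> = x powr (real m + a)" using assms(3) by (simp add: powr_add powr_realpow)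
  also have "\<dots> = (x powr ((real m + a) / 5)) ^ Suc 4"
    using powr_rational_power[of "x powr (real m + a)" 5 1] assms(3) by (simp add: powr_powr)
  finally show ?thesis by (rule power_le_imp_le_base) simp
qed

lemma fifth_root_step_le:
  fixes x t u :: real
  assumes "x ^ m * u \<le> t ^ 5" "x powr a \<le> u" "x > 0" "t \<ge> 0"
  shows "x powr ((real m + a) / 5) \<le> t"
proof -
  have "(x powr ((real m + a) / 5)) ^ Suc 4 = x powr (real m + a)"
    using powr_rational_power[of "x powr (real m + a)" 5 1] assms(3) by (simp add: powr_powr)
  also have "\<dots> = x ^ m * x powr a" using assms(3) by (simp add: powr_add powr_realpow)
  also have "\<dots> \<le> t ^ Suc 4"
    using assms order.trans[OF mult_left_mono[OF assms(2)] assms(1)] by simp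
  finally show ?thesis using assms(4) by (rule power_le_imp_le_base)
qed

text \<open>Since 233/125 = 1 + (4 + (1 + 3/5)/5)/5, this power is reached by three fifth roots.  Rounding
  after each root keeps the numbers short; a direct comparison of 125th powers would involve numbers
  with hundreds of digits.\<close>

lemma le_powr_233_125:
  fixes x :: real
  assumes "x > 0" "ta ^ 5 \<le> x ^ 3" "tb ^ 5 \<le> x * ta" "tc ^ 5 \<le> x ^ 4 * tb"
  shows "x * tc \<le> x powr (233 / 125)"
proof -
  have "ta \<le> x powr ((real 3 + 0) / 5)"
    by (rule le_fifth_root_step[where u = 1]) (use assms in auto)
  hence "tb \<le> x powr ((real 1 + (real 3 + 0) / 5) / 5)"
    by (rule le_fifth_root_step[rotated]) (use assms in auto)
  hence "tc \<le> x powr ((real 4 + (real 1 + (real 3 + 0) / 5) / 5) / 5)"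
    by (rule le_fifth_root_step[rotated]) (use assms in auto)
  thus ?thesis
    using powr_add[of x 1 "108 / 125"] assms(1) by simp
qed

lemma powr_233_125_le:
  fixes x :: real
  assumes "x > 0" "x ^ 3 \<le> ta ^ 5" "x * ta \<le> tb ^ 5" "x ^ 4 * tb \<le> tc ^ 5"
    and "ta \<ge> 0" "tb \<ge> 0" "tc \<ge> 0"
  shows "x powr (233 / 125) \<le> x * tc"
proof -
  have "x powr ((real 3 + 0) / 5) \<le> ta"
    by (rule fifth_root_step_le[where u = 1]) (use assms in auto)
  hence "x powr ((real 1 + (real 3 + 0) / 5) / 5) \<le> tb"
    by (rule fifth_root_step_le[rotated]) (use assms in auto)
  hence "x powr ((real 4 + (real 1 + (real 3 + 0) / 5) / 5) / 5) \<le> tc"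
    by (rule fifth_root_step_le[rotated]) (use assms in auto)
  thus ?thesis
    using powr_add[of x 1 "108 / 125"] assms(1) by simp
qed

lemma powr_minus_233_125_bounds:
  fixes x :: real
  assumes "x > 0" "sa ^ 5 \<le> x ^ 3" "sb ^ 5 \<le> x * sa" "sc ^ 5 \<le> x ^ 4 * sb" "1 \<le> hi * (x * sc)"
    and "x ^ 3 \<le> ta ^ 5" "x * ta \<le> tb ^ 5" "x ^ 4 * tb \<le> tc ^ 5" "lo * (x * tc) \<le> 1"
    and "ta \<ge> 0" "tb \<ge> 0" "tc \<ge> 0" "hi \<ge> 0" "lo \<ge> 0"
  shows "x powr - (233 / 125) \<in> {lo..hi}"
proof -
  have "1 \<le> hi * x powr (233 / 125)"
    using order.trans[OF assms(5) mult_left_mono[OF le_powr_233_125]] assms by simp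
  moreover have "lo * x powr (233 / 125) \<le> 1"
    using order.trans[OF mult_left_mono[OF powr_233_125_le] assms(9)] assms by simp
  ultimately show ?thesis using assms(1) by (simp add: powr_minus_divide field_simps)
qed

lemma powr_minus_bounds_mult:
  fixes x y :: real
  assumes "x powr - r \<in> {a..b}" "y powr - r \<in> {c..d}" "0 \<le> a" "0 \<le> c"
    and "l \<le> a * c" "b * d \<le> h"
  shows "(x * y) powr - r \<in> {l..h}"
proof -
  have "a * c \<le> x powr - r * y powr - r" "x powr - r * y powr - r \<le> b * d"
    using assms by (auto intro!: mult_mono)
  thus ?thesis using assms(5,6) by (simp add: powr_mult)
qed

section \<open>Numerical facts about the steps at two and three\<close>

text \<open>The multiples of \<open>p\<close> in \<open>A\<close> are exactly \<open>p\<close> times the elements of \<open>A\<close>.\<close>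

lemma dsum_not_dvd:
  assumes s: "s > 1" and p: "p > 0" and A: "\<And>n. p * n \<in> A \<longleftrightarrow> n \<in> A"
  shows "dsum {n\<in>A. \<not> p dvd n} s = (1 - 1 / real p powr s) * dsum A s"
proof -
  have "A = {n\<in>A. \<not> p dvd n} \<union> (*) p ` A"
  proof (intro set_eqI iffI)
    fix x assume "x \<in> A"
    thus "x \<in> {n\<in>A. \<not> p dvd n} \<union> (*) p ` A" using A by (cases "p dvd x") (auto elim!: dvdE)
  next
    fix x assume "x \<in> {n\<in>A. \<not> p dvd n} \<union> (*) p ` A"
    thus "x \<in> A" using A by blast
  qed
  hence "dsum A s = dsum ({n\<in>A. \<not> p dvd n} \<union> (*) p ` A) s" by simp
  also have "\<dots> = dsum {n\<in>A. \<not> p dvd n} s + dsum ((*) p ` A) s"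
    by (rule dsum_Un_disjoint[OF s]) auto
  also have "dsum ((*) p ` A) s = 1 / real p powr s * dsum A s"
    using dsum_times_left[OF p, of A s] by (simp add: powr_minus_divide)
  finally show ?thesis by (simp add: algebra_simps)
qed

lemma dsum_odd:
  assumes "s > 1"
  shows "dsum {n\<in>{1..}. \<not> 2 dvd n} s = (1 - 1 / 2 powr s) * zeta s"
  using dsum_not_dvd[OF assms, of 2 "{1..}"] zeta_eq_dsum[OF assms] by simp

lemma rough_subset_not_dvd:
  "prime p \<Longrightarrow> rough k p \<subseteq> {n\<in>{1..}. \<not> p dvd n}"
  using not_dvd_rough by (auto simp: rough_def power_free_def Suc_le_eq)

text \<open>All odd numbers together contribute less than 5/4 at the exponent 2; this bounds \<open>eta 1\<close>
  from above by 2.\<close>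

lemma squarefree_step_2_false: "\<not> small_step 1 2 2"
proof -
  have "zeta 2 \<le> (\<Sum>n=1..5. real n powr - 2) + real 5 powr (1 - 2) / (2 - 1)"
    by (rule zeta_le) auto
  also have "\<dots> = 1 + 1 / 4 + 1 / 9 + 1 / 16 + 1 / 25 + 1 / 5"
    by (simp add: powr_minus_divide eval_nat_numeral)
  finally have z: "zeta 2 < 5 / 3" by simp
  have "dsum (rough 1 2) 2 \<le> dsum {n\<in>{1..}. \<not> 2 dvd n} 2"
    using rough_subset_not_dvd[OF two_is_prime_nat] by (intro dsum_mono) auto
  also have "\<dots> = 3 / 4 * zeta 2" using dsum_odd[of 2] by simp
  finally have "dsum (rough 1 2) 2 < 5 / 4" using z by simp
  thus ?thesis by (simp add: small_step_def)
qed

text \<open>This bounds \<open>eta 1\<close> from below.  The true margin between \<open>zeta r\<close> and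
  \<open>zeta (2 * r) * (1 + 1 / 2 powr r)\<^sup>2\<close> is about 0.00028, which dictates six decimals for the powers and
  16 terms for the zeta values.\<close>

lemma squarefree_step_2_true: "small_step 1 2 (233 / 125)"
proof -
  define r :: real where "r = 233 / 125"
  have r: "r > 1" by (simp add: r_def)
  have b2: "real 2 powr - r \<in> {274713 / 1000000..274714 / 1000000}"
    unfolding r_def
    by (rule powr_minus_233_125_bounds[where sa = "151571656 / 100000000"
          and sb = "124833054 / 100000000" and sc = "182007764 / 100000000"
          and ta = "151571657 / 100000000" and tb = "124833055 / 100000000" and tc = "182007765 / 100000000"])
       (simp_all add: power_divide)
  have b3: "real 3 powr - r \<in> {129016 / 1000000..129017 / 1000000}"
    unfolding r_def
    by (rule powr_minus_233_125_bounds[where sa = "193318204 / 100000000"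
          and sb = "142127723 / 100000000" and sc = "258364454 / 100000000"
          and ta = "193318205 / 100000000" and tb = "142127725 / 100000000" and tc = "258364456 / 100000000"])
       (simp_all add: power_divide)
  have b4: "real 4 powr - r \<in> {75467 / 1000000..75468 / 1000000}"
    using powr_minus_bounds_mult[OF b2 b2, where l = "75467 / 1000000" and h = "75468 / 1000000"] by simp
  have b5: "real 5 powr - r \<in> {49787 / 1000000..49788 / 1000000}"
    unfolding r_def
    by (rule powr_minus_233_125_bounds[where sa = "262652780 / 100000000"
          and sb = "167367219 / 100000000" and sc = "401707632 / 100000000"
          and ta = "262652781 / 100000000" and tb = "167367220 / 100000000" and tc = "401707633 / 100000000"])
       (simp_all add: power_divide)
  have b6: "real 6 powr - r \<in> {35442 / 1000000..35443 / 1000000}"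
    using powr_minus_bounds_mult[OF b2 b3, where l = "35442 / 1000000" and h = "35443 / 1000000"] by simp
  have b7: "real 7 powr - r \<in> {26591 / 1000000..26592 / 1000000}"
    unfolding r_def
    by (rule powr_minus_233_125_bounds[where sa = "321409584 / 100000000"
          and sb = "186393761 / 100000000" and sc = "537235504 / 100000000"
          and ta = "321409585 / 100000000" and tb = "186393762 / 100000000" and tc = "537235506 / 100000000"])
       (simp_all add: power_divide)
  have b8: "real 8 powr - r \<in> {20731 / 1000000..20733 / 1000000}"
    using powr_minus_bounds_mult[OF b2 b4, where l = "20731 / 1000000" and h = "20733 / 1000000"] by simp
  have b9: "real 9 powr - r \<in> {16645 / 1000000..16646 / 1000000}"
    using powr_minus_bounds_mult[OF b3 b3, where l = "16645 / 1000000" and h = "16646 / 1000000"] by simp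
  have b10: "real 10 powr - r \<in> {13677 / 1000000..13678 / 1000000}"
    using powr_minus_bounds_mult[OF b2 b5, where l = "13677 / 1000000" and h = "13678 / 1000000"] by simp
  have b11: "real 11 powr - r \<in> {11451 / 1000000..11452 / 1000000}"
    unfolding r_def
    by (rule powr_minus_233_125_bounds[where sa = "421536913 / 100000000"
          and sb = "215399980 / 100000000" and sc = "793895389 / 100000000"
          and ta = "421536914 / 100000000" and tb = "215399981 / 100000000" and tc = "793895391 / 100000000"])
       (simp_all add: power_divide)
  have b12: "real 12 powr - r \<in> {9736 / 1000000..9737 / 1000000}"
    using powr_minus_bounds_mult[OF b2 b6, where l = "9736 / 1000000" and h = "9737 / 1000000"] by simp
  have b13: "real 13 powr - r \<in> {8387 / 1000000..8388 / 1000000}"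
    unfolding r_def
    by (rule powr_minus_233_125_bounds[where sa = "465978642 / 100000000"
          and sb = "227228014 / 100000000" and sc = "917164119 / 100000000"
          and ta = "465978643 / 100000000" and tb = "227228015 / 100000000" and tc = "917164121 / 100000000"])
       (simp_all add: power_divide)
  have b14: "real 14 powr - r \<in> {7304 / 1000000..7306 / 1000000}"
    using powr_minus_bounds_mult[OF b2 b7, where l = "7304 / 1000000" and h = "7306 / 1000000"] by simp
  have b15: "real 15 powr - r \<in> {6423 / 1000000..6424 / 1000000}"
    using powr_minus_bounds_mult[OF b3 b5, where l = "6423 / 1000000" and h = "6424 / 1000000"] by simp
  have b16: "real 16 powr - r \<in> {5695 / 1000000..5696 / 1000000}"
    using powr_minus_bounds_mult[OF b2 b8, where l = "5695 / 1000000" and h = "5696 / 1000000"] by simp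
  note bounds = b2 b3 b4 b5 b6 b7 b8 b9 b10 b11 b12 b13 b14 b15 b16
  note lo = bounds[unfolded atLeastAtMost_iff, THEN conjunct1]
  note hi = bounds[unfolded atLeastAtMost_iff, THEN conjunct2]
  have lower: "1793680 / 1000000 \<le> zeta r"
  proof -
    have "real 16 powr (1 - r) / (r - 1) = 2000 / 108 * real 16 powr - r"
      by (subst powr_one_minus) (simp_all add: r_def)
    hence "(\<Sum>n=1..<16. real n powr - r) + real 16 powr - r / 2 + 2000 / 108 * real 16 powr - r \<le> zeta r"
      using zeta_ge[OF r, of 16] by simp
    thus ?thesis using lo by (simp add: atLeastLessThan_nat_numeral)
  qed
  have upper: "zeta (2 * r) \<le> 1103759 / 1000000"
  proof -
    have sq: "real n powr - (2 * r) = (real n powr - r) ^ 2" for n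
      by (simp add: powr_add[symmetric] power2_eq_square)
    have end_term: "real 16 powr (1 - 2 * r) / (2 * r - 1) = 2000 / 341 * (real 16 powr - r) ^ 2"
      unfolding sq[symmetric] by (subst powr_one_minus) (simp_all add: r_def)
    have range: "{1..16} = {1..<17::nat}" by auto
    have "zeta (2 * r) \<le> (\<Sum>n=1..16. real n powr - (2 * r)) + real 16 powr (1 - 2 * r) / (2 * r - 1)"
      by (rule zeta_le) (use r in auto)
    hence "zeta (2 * r) \<le> (\<Sum>n=1..<17. (real n powr - r) ^ 2) + 2000 / 341 * (real 16 powr - r) ^ 2"
      unfolding end_term range sq .
    thus ?thesis
      using hi[THEN power_mono, of 2] by (simp add: atLeastLessThan_nat_numeral power_divide)
  qed
  have a: "1 / 2 powr r \<le> 274714 / 1000000" "1 / 2 powr r \<ge> 0"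
    using hi(1) by (simp_all add: powr_minus_divide)
  show ?thesis
  proof (rule ccontr)
    assume "\<not> ?thesis"
    hence less: "dsum (rough 1 2) r < 1 + 1 / 2 powr r"
      by (simp add: small_step_def r_def)
    have e: "euler_factor 1 2 r = 1 + 1 / 2 powr r" by (simp add: euler_factor_def)
    have "zeta r = zeta (2 * r) * ((1 + 1 / 2 powr r) * dsum (rough 1 2) r)"
      using zeta_factor_2[OF r, of 1] unfolding e by simp
    also have "\<dots> < zeta (2 * r) * ((1 + 1 / 2 powr r) * (1 + 1 / 2 powr r))"
    proof (intro mult_strict_left_mono zeta_pos)
      show "0 < 1 + 1 / 2 powr r" using a(2) by linarith
    qed (use less r in auto)
    also have "\<dots> \<le> 1103759 / 1000000 * ((1 + 274714 / 1000000) * (1 + 274714 / 1000000))"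
      using upper a by (intro mult_mono) auto
    also have "\<dots> < 1793680 / 1000000" by simp
    finally show False using lower by simp
  qed
qed

text \<open>The numbers coprime to 6 together contribute less than \<open>1 + 1 / 3 powr s\<close>; this bounds \<open>eta k\<close> for
  \<open>k > 1\<close> from above.\<close>

lemma step_3_false:
  "\<not> small_step k 3 (31 / 16)"
proof -
  define s :: real where "s = 31 / 16"
  have s: "s = real 31 / real 16" "s > 1" by (simp_all add: s_def)
  have hi: "real 2 powr - s \<le> 2611 / 10000"
    "real 3 powr - s \<le> 1191 / 10000"
    "real 4 powr - s \<le> 682 / 10000"
    "real 5 powr - s \<le> 443 / 10000"
    "real 6 powr - s \<le> 311 / 10000"
    "real 7 powr - s \<le> 231 / 10000"
    "real 8 powr - s \<le> 178 / 10000"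
    "real 9 powr - s \<le> 142 / 10000"
    "real 10 powr - s \<le> 116 / 10000"
    unfolding s(1) by (rule powr_minus_rational_le; simp add: power_divide)+
  have lo: "2610 / 10000 \<le> real 2 powr - s" "1190 / 10000 \<le> real 3 powr - s"
    unfolding s(1) by (rule powr_minus_rational_ge; simp add: power_divide)+
  have upper: "zeta s \<le> 17143 / 10000"
  proof -
    have end_term: "real 10 powr (1 - s) / (s - 1) = 160 / 15 * real 10 powr - s"
      by (subst powr_one_minus) (simp_all add: s_def)
    have range: "{1..10} = {1..<11::nat}" by auto
    have "zeta s \<le> (\<Sum>n=1..10. real n powr - s) + real 10 powr (1 - s) / (s - 1)"
      by (rule zeta_le[OF s(2)]) simp
    hence "zeta s \<le> (\<Sum>n=1..<11. real n powr - s) + 160 / 15 * real 10 powr - s"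
      unfolding end_term range .
    thus ?thesis using hi by (simp add: atLeastLessThan_nat_numeral)
  qed
  let ?O = "{n\<in>{1::nat..}. \<not> 2 dvd n}"
  have "dsum (rough k 3) s \<le> dsum {n\<in>?O. \<not> 3 dvd n} s"
  proof (rule dsum_mono[OF s(2)])
    have "\<not> 2 dvd n" if "n \<in> rough k 3" for n
      using that two_is_prime_nat unfolding rough_def by fastforce
    thus "rough k 3 \<subseteq> {n\<in>?O. \<not> 3 dvd n}"
      using rough_subset_not_dvd[of 3 k] by auto
  qed
  also have "\<dots> = (1 - 1 / 3 powr s) * ((1 - 1 / 2 powr s) * zeta s)"
    using dsum_not_dvd[OF s(2), of 3 ?O] dsum_odd[OF s(2)] by auto
  also have "\<dots> \<le> (1 - 1190 / 10000) * ((1 - 2610 / 10000) * (17143 / 10000))"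
  proof -
    have "2610 / 10000 \<le> 1 / 2 powr s" "1 / 2 powr s \<le> 2611 / 10000"
      "1190 / 10000 \<le> 1 / 3 powr s" "1 / 3 powr s \<le> 1191 / 10000"
      using lo hi(1,2) by (simp_all only: powr_minus_divide of_nat_numeral)
    thus ?thesis
      using upper zeta_pos[OF s(2)] by (intro mult_mono mult_nonneg_nonneg) linarith+
  qed
  also have "\<dots> < 1 + 1190 / 10000" by simp
  also have "\<dots> \<le> 1 + 1 / 3 powr s" using lo(2) by (simp add: powr_minus_divide)
  finally show ?thesis by (simp add: small_step_def s_def)
qed

text \<open>The primes 5, 7 and 11 suffice at the exponent 5/4, so the threshold of the step at 3 is at least 5/4.\<close>

lemma step_3_true:
  assumes "k > 0"
  shows "small_step k 3 (5 / 4)"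
proof -
  have s: "5 / 4 = real 5 / real 4" by simp
  have lo: "13 / 100 \<le> real 5 powr - (5 / 4)" "8 / 100 \<le> real 7 powr - (5 / 4)"
      "49 / 1000 \<le> real 11 powr - (5 / 4)"
    unfolding s by (rule powr_minus_rational_ge; simp add: power_divide)+
  have hi: "real 3 powr - (5 / 4) \<le> 254 / 1000"
    unfolding s by (rule powr_minus_rational_le; simp add: power_divide)
  show ?thesis
    by (rule small_step_if_primes[where B = "{5, 7, 11}"])
       (use assms lo hi in \<open>auto simp: powr_minus_divide\<close>)
qed

section \<open>Comparing the steps at two and three\<close>

text \<open>With \<open>x = 1 / 2 powr r\<close> and \<open>y = 1 / 3 powr r\<close>, the step at 2 says that \<open>1 + x\<close> is at most \<open>1 + y\<close> times the
  tail beyond 3.  So the step at 3 follows from \<open>(1 + y)\<^sup>2 \<le> 1 + x\<close>, which divided by \<open>y\<close> is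
  \<open>2 + y \<le> (3 / 2) powr r\<close>; the two sides are nearly equal at \<open>r = 233 / 125\<close>.\<close>

lemma squarefree_step_3_if_step_2:
  assumes r: "233 / 125 \<le> r" and step: "small_step 1 2 r"
  shows "small_step 1 3 r"
proof -
  let ?x = "1 / 2 powr r" and ?y = "1 / 3 powr r"
  have r1: "r > 1" using r by simp
  have "3 / 2 * (141952435 / 100000000) \<le> (3 / 2 :: real) powr (233 / 125)"
    by (rule le_powr_233_125[where ta = "127542450 / 100000000" and tb = "113854238 / 100000000"])
       (simp_all add: power_divide)
  also have "\<dots> \<le> (3 / 2) powr r" using r by (intro powr_mono) auto
  finally have 1: "3 / 2 * (141952435 / 100000000) \<le> (3 / 2) powr r" .
  have "?y = 3 powr - r" by (simp add: powr_minus_divide)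
  also have "\<dots> \<le> 3 powr - (233 / 125)" using r by (intro powr_mono) auto
  also have "\<dots> \<le> 129017 / 1000000"
  proof -
    have "(3::real) powr - (233 / 125) \<in> {129016 / 1000000..129017 / 1000000}"
      by (rule powr_minus_233_125_bounds[where sa = "193318204 / 100000000" and sb = "142127723 / 100000000" and sc = "258364454 / 100000000"
          and ta = "193318205 / 100000000" and tb = "142127725 / 100000000" and tc = "258364456 / 100000000"]) (simp_all add: power_divide)
    thus ?thesis by simp
  qed
  finally have 2: "2 + ?y \<le> (3 / 2) powr r" using 1 by simp
  have y: "?y > 0" by simp
  have "(2 + ?y) * ?y \<le> (3 / 2) powr r * ?y" using 2 y by (intro mult_right_mono) auto
  also have "\<dots> = ?x" by (simp add: powr_divide)
  finally have "(1 + ?y) * (1 + ?y) \<le> 1 + ?x" by (simp add: algebra_simps)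
  also have "\<dots> \<le> dsum (rough 1 2) r" using step by (simp add: small_step_def)
  also have "\<dots> = (1 + ?y) * dsum (rough 1 3) r"
    using dsum_rough_2[OF r1, of 1] by (simp add: euler_factor_def)
  finally have "1 + ?y \<le> dsum (rough 1 3) r"
    using y by (simp add: mult_le_cancel_left_pos add_pos_pos)
  thus ?thesis by (simp add: small_step_def)
qed

text \<open>With \<open>x\<close> and \<open>y\<close> as before, the Euler factor at 3 is now at least \<open>1 + y + y\<^sup>2\<close>, and
  \<open>1 + x \<le> (1 + y + y\<^sup>2) * (1 + y)\<close> holds as long as \<open>(3 / 2) powr r \<le> 2 + 2 * y\<close>.\<close>

lemma step_2_if_step_3:
  assumes k: "k \<ge> 2" and r: "1 < r" "r \<le> 31 / 16" and step: "small_step k 3 r"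
  shows "small_step k 2 r"
proof -
  let ?x = "1 / 2 powr r" and ?y = "1 / 3 powr r"
  have y: "?y > 0" by simp
  have "119 / 1000 \<le> real 3 powr - (real 31 / real 16)"
    by (rule powr_minus_rational_ge) (simp_all add: power_divide)
  also have "\<dots> \<le> real 3 powr - r" using r by (intro powr_mono) auto
  also have "\<dots> = ?y" by (simp add: powr_minus_divide)
  finally have ylo: "119 / 1000 \<le> ?y" .
  have "(3 / 2) powr r \<le> (3 / 2) powr (real 31 / real 16)" using r by (intro powr_mono) auto
  also have "\<dots> \<le> 22 / 10" by (rule powr_rational_le) (simp_all add: power_divide)
  also have "\<dots> \<le> 2 + 2 * ?y" using ylo by linarith
  finally have "(3 / 2) powr r * ?y \<le> (2 + 2 * ?y) * ?y" using y by (intro mult_right_mono) auto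
  moreover have "?x = (3 / 2) powr r * ?y" by (simp add: powr_divide)
  ultimately have "?x \<le> (2 + 2 * ?y) * ?y" by simp
  hence "1 + ?x \<le> 1 + 2 * ?y + 2 * (?y * ?y)" by (simp add: algebra_simps)
  also have "\<dots> \<le> 1 + 2 * ?y + 2 * (?y * ?y) + ?y * (?y * ?y)" using y by simp
  also have "\<dots> = (1 + ?y + ?y * ?y) * (1 + ?y)"
  proof -
    have "1 + 2 * y + 2 * (y * y) + y * (y * y) = (1 + y + y * y) * (1 + y)" for y :: real
      by (simp add: algebra_simps)
    thus ?thesis .
  qed
  also have "\<dots> \<le> euler_factor k 3 r * dsum (rough k 3) r"
  proof (rule mult_mono)
    have "?y * ?y = 1 / 3 powr (r * 2)" by (simp add: mult.commute flip: powr_add)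
    hence "1 + ?y + ?y * ?y = (\<Sum>i=0..2. 1 / real 3 powr (r * real i))"
      by (simp add: eval_nat_numeral)
    also have "\<dots> \<le> euler_factor k 3 r"
      unfolding euler_factor_def using k by (intro sum_mono2) auto
    finally show "1 + ?y + ?y * ?y \<le> euler_factor k 3 r" .
    show "0 \<le> euler_factor k 3 r" using euler_factor_ge_1[of 3 k r] by simp
  qed (use step y in \<open>auto simp: small_step_def\<close>)
  also have "\<dots> = dsum (rough k 2) r" using dsum_rough_2[OF r(1)] by simp
  finally show ?thesis by (simp add: small_step_def)
qed

section \<open>The thresholds and the theorem\<close>

text \<open>The prime whose inequality is the first to fail as the exponent grows.\<close>

definition pivot :: "nat \<Rightarrow> nat" where
  "pivot k = (if k = 1 then 2 else 3)"

text \<open>After cancelling the common Euler factors, the defining equations of \<open>eta\<close> state equality in the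
  step at the pivot.\<close>

lemma eta_eq_pivot:
  assumes "k > 0"
  shows "eta k = (THE x. 1 < x \<and> x < 2 \<and> dsum (rough k (pivot k)) x = 1 + 1 / real (pivot k) powr x)"
proof (cases "k = 1")
  case True
  have "(1 + 1 / 2 powr x) ^ 2 = zeta x / zeta (2 * x) \<longleftrightarrow> dsum (rough 1 2) x = 1 + 1 / 2 powr x"
    if "x > 1" for x
  proof -
    have "euler_factor 1 2 x = 1 + 1 / 2 powr x" by (simp add: euler_factor_def)
    hence "zeta x / zeta (2 * x) = (1 + 1 / 2 powr x) * dsum (rough 1 2) x"
      using zeta_quotient[OF that, of 1] by simp
    moreover have "1 + 1 / 2 powr x > 0" by (simp add: add_pos_nonneg)
    ultimately show ?thesis by (auto simp: power2_eq_square)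
  qed
  hence "(\<lambda>x. 1 < x \<and> x < 2 \<and> (1 + 1 / 2 powr x) ^ 2 = zeta x / zeta (2 * x))
      = (\<lambda>x. 1 < x \<and> x < 2 \<and> dsum (rough 1 2) x = 1 + 1 / 2 powr x)"
    by (intro ext) auto
  thus ?thesis using True by (simp add: eta_def pivot_def)
next
  case False
  have "euler_factor k 2 x * euler_factor k 3 x * (1 + 1 / 3 powr x) = zeta x / zeta (real (k + 1) * x)
      \<longleftrightarrow> dsum (rough k 3) x = 1 + 1 / 3 powr x" if "x > 1" for x
  proof -
    have "zeta x / zeta (real (k + 1) * x) = euler_factor k 2 x * euler_factor k 3 x * dsum (rough k 3) x"
      using zeta_quotient[OF that, of k] dsum_rough_2[OF that, of k] by simp
    moreover have "euler_factor k 2 x > 0" "euler_factor k 3 x > 0"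
      using euler_factor_ge_1[of 2 k x] euler_factor_ge_1[of 3 k x] by auto
    ultimately show ?thesis by auto
  qed
  hence "(\<lambda>x. 1 < x \<and> x < 2 \<and>
        euler_factor k 2 x * euler_factor k 3 x * (1 + 1 / 3 powr x) = zeta x / zeta (real (k + 1) * x))
      = (\<lambda>x. 1 < x \<and> x < 2 \<and> dsum (rough k 3) x = 1 + 1 / 3 powr x)"
    by (intro ext) auto
  thus ?thesis using False by (simp add: eta_def pivot_def euler_factor_def)
qed

lemma eta_threshold:
  assumes "k > 0"
  shows "eta k < 2" "r > 1 \<Longrightarrow> small_step k (pivot k) r \<longleftrightarrow> r \<le> eta k"
    and "k = 1 \<Longrightarrow> 233 / 125 \<le> eta k" "k \<noteq> 1 \<Longrightarrow> eta k < 31 / 16"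
proof -
  define b :: real where "b = (if k = 1 then 2 else 31 / 16)"
  define a :: real where "a = (if k = 1 then 233 / 125 else 5 / 4)"
  have p: "pivot k > 0" by (simp add: pivot_def)
  have ab: "1 < a" "a < b" "b \<le> 2" by (auto simp: a_def b_def)
  have true: "small_step k (pivot k) a"
    using squarefree_step_2_true step_3_true[OF assms] by (auto simp: a_def pivot_def)
  have false: "\<not> small_step k (pivot k) b"
    using squarefree_step_2_false step_3_false[of k] by (auto simp: b_def pivot_def)
  note threshold = small_step_threshold[OF p ab true false, folded eta_eq_pivot[OF assms]]
  show "eta k < 2" using threshold(2) ab(3) by simp
  show "r > 1 \<Longrightarrow> small_step k (pivot k) r \<longleftrightarrow> r \<le> eta k" by (rule threshold(3))
  show "k = 1 \<Longrightarrow> 233 / 125 \<le> eta k" using threshold(1) by (simp add: a_def)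
  show "k \<noteq> 1 \<Longrightarrow> eta k < 31 / 16" using threshold(2) by (simp add: b_def)
qed

text \<open>For \<open>k = 1\<close> the step at 3 is obtained at the exponent \<open>eta 1\<close> and then transferred to \<open>r\<close>, since the
  implication from the step at 2 is not available for small \<open>r\<close>.\<close>

lemma all_small_steps_iff:
  assumes k: "k > 0" and r: "r > 1"
  shows "(\<forall>p. prime p \<longrightarrow> small_step k p r) \<longleftrightarrow> r \<le> eta k"
proof
  assume "\<forall>p. prime p \<longrightarrow> small_step k p r"
  moreover have "prime (pivot k)" by (simp add: pivot_def)
  ultimately show "r \<le> eta k" using eta_threshold(2)[OF k r] by blast
next
  assume le: "r \<le> eta k"
  have pivot: "small_step k (pivot k) r" using eta_threshold(2)[OF k r] le by blast
  have eta1: "eta k > 1" using r le by simp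
  have small: "small_step k 2 r \<and> small_step k 3 r"
  proof (cases "k = 1")
    case True
    have "small_step 1 2 (eta 1)" using eta_threshold(2)[OF k eta1] True by (simp add: pivot_def)
    hence "small_step 1 3 (eta 1)"
      using squarefree_step_3_if_step_2 eta_threshold(3)[OF k True] True by blast
    hence "small_step k 3 r" using small_step_antimono[of 3 r "eta 1" 1] r le True by simp
    thus ?thesis using pivot True by (simp add: pivot_def)
  next
    case False
    hence "small_step k 3 r" using pivot by (simp add: pivot_def)
    thus ?thesis using step_2_if_step_3[of k r] eta_threshold(4)[OF k False] r le k False by auto
  qed
  show "\<forall>p. prime p \<longrightarrow> small_step k p r"
  proof (intro allI impI)
    fix p :: nat assume p: "prime p"
    show "small_step k p r"
    proof (cases "p \<ge> 5")
      case True
      thus ?thesis using small_step_large_prime[OF r _ k p] le eta_threshold(1)[OF k] by simp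
    next
      case False
      hence "p = 2 \<or> p = 3 \<or> p = 4" using prime_ge_2_nat[OF p] by linarith
      thus ?thesis using small p by auto
    qed
  qed
qed

theorem theorem2p3:
  fixes k :: nat and r :: real
  assumes "k > 0" and "r > 1"
  shows "{1..<zeta r / zeta (real (k + 1) * r)} \<subseteq> closure (divisor_sigma (- r) ` power_free k)
    \<longleftrightarrow> r \<le> eta k"
proof -
  have "zeta r / zeta (real (k + 1) * r) = dsum (power_free k) r"
    using zeta_quotient[OF assms(2), of k] dsum_rough_prime[OF two_is_prime_nat assms(2), of k]
      rough_nonprime[of 0 k] by (simp add: rough_0)
  moreover have "{1..<dsum (power_free k) r} \<subseteq> closure (divisor_sigma (- r) ` power_free k)
      \<longleftrightarrow> (\<forall>p. prime p \<longrightarrow> small_step k p r)"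
    using dense_if_small_steps[OF assms(2), of k] small_steps_if_dense[OF assms(2,1)]
    by blast
  ultimately show ?thesis using all_small_steps_iff[OF assms] by simp
qed

end
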